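(* Let $G=(V,E)$ be a polytree and let $J$ be the ideal generated by the linear generators of $\mathcal{I}^{\leq 3}(G)$ (namely the variables $s_{ij}$ for which there is no 2-trek between $i,j$ and the variables $t_{ijk}$ for which there is no 3-trek between $i,j,k$) and the $2$-minors of the trek-matrices $A_{i,j}$ for $i\to j\in E$. Then $$\mathcal{M}^{\leq 3}(G)=\mathcal{V}(J)\cap\big(PD(V)\times\mathrm{Sym}_3(V)\big).$$
   Context: A polytree is a finite directed acyclic graph $G=(V,E)$, $V=\{1,\dots,n\}$, whose underlying undirected graph is a tree. $\mathbb{R}^E$ denotes the set of real $V\times V$ matrices $\Lambda=(\lambda_{ij})$ with $\lambda_{ij}=0$ whenever $i\to j\notin E$. $PD(V)$ is the cone of positive definite symmetric matrices in $\mathbb{R}^{V\times V}$ and $\mathrm{Sym}_3(V)$ is the space of symmetric tensors in $\mathbb{R}^{V\times V\times V}$. The third-order moment model $\mathcal{M}^{\leq 3}(G)\subseteq PD(V)\times\mathrm{Sym}_3(V)$ is the set of all pairs $(S,T)$ with $$S=(I-\Lambda)^{-T}\Omega^{(2)}(I-\Lambda)^{-1},\qquad T=\Omega^{(3)}\bullet(I-\Lambda)^{-1}\bullet(I-\Lambda)^{-1}\bullet(I-\Lambda)^{-1},$$ where $\Omega^{(2)}\in PD(V)$ is diagonal, $\Omega^{(3)}\in\mathrm{Sym}_3(V)$ is diagonal, and $\Lambda\in\mathbb{R}^E$; the Tucker product is $(\Omega\bullet M\bullet M\bullet M)_{ijk}=\sum_{a,b,c}\Omega_{abc}M_{ai}M_{bj}M_{ck}$.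 The third-order moment ideal $\mathcal{I}^{\leq 3}(G)\subseteq\mathbb{C}[s_{ij},t_{ijk}\mid 1\le i\le j\le k\le n]$ is the ideal of all polynomials in the entries $S=(s_{ij})$, $T=(t_{ijk})$ that vanish on $\mathcal{M}^{\leq 3}(G)$ (indices of $s$ and $t$ are symmetric). $\mathcal{V}(J)$ is the set of common zeros $(S,T)$ of $J$. A $k$-trek between $i_1,\dots,i_k\in V$ is an ordered collection $\tau=(P_1,\dots,P_k)$ of directed paths (possibly empty, i.e. a single vertex) such that $P_r$ has sink $i_r$ and all $P_r$ share the same source, called the top of $\tau$. It is simple if its top is the only vertex lying on all $k$ paths. In a polytree, if a $k$-trek between $i_1,\dots,i_k$ exists, there is a unique simple one, and $\operatorname{top}(i_1,\dots,i_k)$ denotes its top. Trek-matrix: for vertices $i,j$ of a polytree such that a 2-trek between $i$ and $j$ exists, $$A_{i,j}=\begin{pmatrix}s_{ik_1}&\cdots&s_{ik_r}&t_{i\ell_1m_1}&\cdots&t_{i\ell_qm_q}\\ s_{jk_1}&\cdots&s_{jk_r}&t_{j\ell_1m_1}&\cdots&t_{j\ell_qm_q}\end{pmatrix},$$ where $k_1,\dots,k_r$ are all vertices $k$ such that $\operatorname{top}(i,k)$ and $\operatorname{top}(j,k)$ exist and are equal, and $(\ell_1,m_1),\dots,(\ell_q,m_q)$ are all (unordered, possibly repeated-entry) pairs of vertices $(\ell,m)$ such that $\operatorname{top}(i,\ell,m)$ and $\operatorname{top}(j,\ell,m)$ exist and are equal. *)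

theory Defs
  imports "HOL-Analysis.Analysis" "HOL-Library.Poly_Mapping" "HOL.Hull"
begin

section \<open>Polytrees and treks\<close>

text \<open>
  The vertex set is the whole (finite, nonempty) type \<open>'v\<close>, i.e. \<open>{1, \<dots>, n}\<close> with
  \<open>n = CARD('v)\<close>; a digraph is given by its edge relation. The linear order on \<open>'v\<close> is only used
  to enumerate the variables \<open>s\<^sub>i\<^sub>j\<close> (\<open>i \<le> j\<close>) and \<open>t\<^sub>i\<^sub>j\<^sub>k\<close> (\<open>i \<le> j \<le> k\<close>); it need not be
  compatible with the edges.
\<close>

definition undirected_connected :: "('v \<times> 'v) set \<Rightarrow> bool" where
  "undirected_connected E \<longleftrightarrow> (\<forall>u v. (u, v) \<in> (E \<union> E\<inverse>)\<^sup>*)"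

definition undirected_cycle :: "('v \<times> 'v) set \<Rightarrow> 'v list \<Rightarrow> bool" where
  "undirected_cycle E c \<longleftrightarrow> 3 \<le> length c \<and> distinct c \<and>
     successively (\<lambda>u v. (u, v) \<in> E \<union> E\<inverse>) c \<and> (last c, hd c) \<in> E \<union> E\<inverse>"

text \<open>\<open>acyclic\<close> excludes directed cycles, in particular loops and pairs of antiparallel edges.\<close>

definition polytree :: "('v \<times> 'v) set \<Rightarrow> bool" where
  "polytree E \<longleftrightarrow> acyclic E \<and> undirected_connected E \<and> (\<nexists>c. undirected_cycle E c)"

text \<open>A path is its nonempty list of vertices. Distinctness is automatic in an acyclic graph.\<close>

definition directed_path :: "('v \<times> 'v) set \<Rightarrow> 'v list \<Rightarrow> bool" where
  "directed_path E p \<longleftrightarrow> p \<noteq> [] \<and> successively (\<lambda>u v. (u, v) \<in> E) p"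

text \<open>\<open>is_trek E is \<tau> v\<close>: \<open>\<tau>\<close> is a \<open>k\<close>-trek with top \<open>v\<close> between the vertices in the list \<open>is\<close>, where
  \<open>k = length is\<close>.\<close>

definition is_trek :: "('v \<times> 'v) set \<Rightarrow> 'v list \<Rightarrow> 'v list list \<Rightarrow> 'v \<Rightarrow> bool" where
  "is_trek E is \<tau> v \<longleftrightarrow>
     list_all2 (\<lambda>i p. directed_path E p \<and> hd p = v \<and> last p = i) is \<tau>"

definition is_simple_trek :: "('v \<times> 'v) set \<Rightarrow> 'v list \<Rightarrow> 'v list list \<Rightarrow> 'v \<Rightarrow> bool" where
  "is_simple_trek E is \<tau> v \<longleftrightarrow> is_trek E is \<tau> v \<and> (\<Inter>p\<in>set \<tau>. set p) = {v}"

definition trek_exists :: "('v \<times> 'v) set \<Rightarrow> 'v list \<Rightarrow> bool" where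
  "trek_exists E is \<longleftrightarrow> (\<exists>\<tau> v. is_trek E is \<tau> v)"

text \<open>Only meaningful if \<open>trek_exists E is\<close>.\<close>

definition top_of :: "('v \<times> 'v) set \<Rightarrow> 'v list \<Rightarrow> 'v" where
  "top_of E is = (THE v. \<exists>\<tau>. is_simple_trek E is \<tau> v)"

definition same_top :: "('v \<times> 'v) set \<Rightarrow> 'v list \<Rightarrow> 'v list \<Rightarrow> bool" where
  "same_top E is js \<longleftrightarrow> trek_exists E is \<and> trek_exists E js \<and> top_of E is = top_of E js"


section \<open>The third-order moment model\<close>

type_synonym ('a, 'v) matrix2 = "'a ^ 'v ^ 'v"
type_synonym ('a, 'v) tensor3 = "'a ^ 'v ^ 'v ^ 'v"

definition sym_matrix :: "('a, 'v::finite) matrix2 \<Rightarrow> bool" where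
  "sym_matrix S \<longleftrightarrow> transpose S = S"

definition PD :: "(real, 'v::finite) matrix2 set" where
  "PD = {S. sym_matrix S \<and> (\<forall>x. x \<noteq> 0 \<longrightarrow> 0 < x \<bullet> (S *v x))}"

definition Sym3 :: "('a, 'v::finite) tensor3 set" where
  "Sym3 = {T. \<forall>i j k. T $ i $ j $ k = T $ j $ i $ k \<and> T $ i $ j $ k = T $ i $ k $ j}"

definition diagonal_matrix :: "('a::zero, 'v::finite) matrix2 \<Rightarrow> bool" where
  "diagonal_matrix S \<longleftrightarrow> (\<forall>i j. i \<noteq> j \<longrightarrow> S $ i $ j = 0)"

definition diagonal_tensor :: "('a::zero, 'v::finite) tensor3 \<Rightarrow> bool" where
  "diagonal_tensor T \<longleftrightarrow> (\<forall>i j k. \<not> (i = j \<and> j = k) \<longrightarrow> T $ i $ j $ k = 0)"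

text \<open>\<open>tucker \<Omega> M\<close> is \<open>\<Omega> \<bullet> M \<bullet> M \<bullet> M\<close>.\<close>

definition tucker ::
    "('a::semiring_1, 'v::finite) tensor3 \<Rightarrow> ('a, 'v) matrix2 \<Rightarrow> ('a, 'v) tensor3" where
  "tucker \<Omega> M = (\<chi> i j k. \<Sum>a\<in>UNIV. \<Sum>b\<in>UNIV. \<Sum>c\<in>UNIV.
     \<Omega> $ a $ b $ c * M $ a $ i * M $ b $ j * M $ c $ k)"

definition edge_matrices :: "('v::finite \<times> 'v) set \<Rightarrow> (real, 'v) matrix2 set" where
  "edge_matrices E = {\<Lambda>. \<forall>i j. (i, j) \<notin> E \<longrightarrow> \<Lambda> $ i $ j = 0}"

definition moment_model ::
    "('v::finite \<times> 'v) set \<Rightarrow> ((real, 'v) matrix2 \<times> (real, 'v) tensor3) set" where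
  "moment_model E =
     {(transpose (matrix_inv (mat 1 - \<Lambda>)) ** \<Omega>2 ** matrix_inv (mat 1 - \<Lambda>),
       tucker \<Omega>3 (matrix_inv (mat 1 - \<Lambda>))) | \<Lambda> \<Omega>2 \<Omega>3.
       \<Lambda> \<in> edge_matrices E \<and> \<Omega>2 \<in> PD \<and> diagonal_matrix \<Omega>2 \<and> \<Omega>3 \<in> Sym3 \<and> diagonal_tensor \<Omega>3}"


section \<open>The polynomial ring\<close>

text \<open>
  The variables \<open>s\<^sub>i\<^sub>j\<close> and \<open>t\<^sub>i\<^sub>j\<^sub>k\<close> are encoded by their sorted index lists \<open>[i, j]\<close> and \<open>[i, j, k]\<close>.
\<close>

typedef (overloaded) 'v moment_var =
  "{is :: 'v::linorder list. sorted is \<and> (length is = 2 \<or> length is = 3)}"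
  by (intro exI[of _ "[undefined, undefined]"]) simp

text \<open>Polynomials are finitely supported functions from monomials (exponent vectors) to
  coefficients, with the convolution product of \<^theory>\<open>HOL-Library.Poly_Mapping\<close>.\<close>

type_synonym 'x cpoly = "('x \<Rightarrow>\<^sub>0 nat) \<Rightarrow>\<^sub>0 complex"

definition pvar :: "'x \<Rightarrow> 'x cpoly" where
  "pvar x = Poly_Mapping.single (Poly_Mapping.single x 1) 1"

definition peval :: "('x \<Rightarrow> complex) \<Rightarrow> 'x cpoly \<Rightarrow> complex" where
  "peval a p = (\<Sum>m\<in>Poly_Mapping.keys p. Poly_Mapping.lookup p m *
     (\<Prod>x\<in>Poly_Mapping.keys m. a x ^ Poly_Mapping.lookup m x))"

definition linear_poly :: "'x cpoly \<Rightarrow> bool" where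
  "linear_poly p \<longleftrightarrow> (\<forall>m\<in>Poly_Mapping.keys p.
     (\<Sum>x\<in>Poly_Mapping.keys m. Poly_Mapping.lookup m x) \<le> 1)"

definition is_ideal :: "'r::comm_ring_1 set \<Rightarrow> bool" where
  "is_ideal I \<longleftrightarrow> 0 \<in> I \<and> (\<forall>x\<in>I. \<forall>y\<in>I. x + y \<in> I) \<and> (\<forall>r. \<forall>x\<in>I. r * x \<in> I)"

definition ideal_gen :: "'r::comm_ring_1 set \<Rightarrow> 'r set" where
  "ideal_gen B = is_ideal hull B"

definition svar :: "'v::linorder \<Rightarrow> 'v \<Rightarrow> 'v moment_var cpoly" where
  "svar i j = pvar (Abs_moment_var (sort [i, j]))"

definition tvar :: "'v::linorder \<Rightarrow> 'v \<Rightarrow> 'v \<Rightarrow> 'v moment_var cpoly" where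
  "tvar i j k = pvar (Abs_moment_var (sort [i, j, k]))"

fun coordinate :: "('a::zero, 'v::finite) matrix2 \<times> ('a, 'v) tensor3 \<Rightarrow> 'v list \<Rightarrow> 'a" where
  "coordinate (S, T) [i, j] = S $ i $ j"
| "coordinate (S, T) [i, j, k] = T $ i $ j $ k"
| "coordinate _ _ = 0"

definition eval_at ::
    "(complex, 'v::{finite, linorder}) matrix2 \<times> (complex, 'v) tensor3
       \<Rightarrow> 'v moment_var cpoly \<Rightarrow> complex" where
  "eval_at ST = peval (\<lambda>x. coordinate ST (Rep_moment_var x))"

definition complexify ::
    "(real, 'v::finite) matrix2 \<times> (real, 'v) tensor3
       \<Rightarrow> (complex, 'v) matrix2 \<times> (complex, 'v) tensor3" where
  "complexify = (\<lambda>(S, T). (\<chi> i j. of_real (S $ i $ j), \<chi> i j k. of_real (T $ i $ j $ k)))"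

definition zero_locus ::
    "'v moment_var cpoly set
       \<Rightarrow> ((complex, 'v::{finite, linorder}) matrix2 \<times> (complex, 'v) tensor3) set" where
  "zero_locus J = {(S, T). sym_matrix S \<and> T \<in> Sym3 \<and> (\<forall>p\<in>J. eval_at (S, T) p = 0)}"

definition moment_ideal :: "('v::{finite, linorder} \<times> 'v) set \<Rightarrow> 'v moment_var cpoly set" where
  "moment_ideal E = {p. \<forall>ST\<in>moment_model E. eval_at (complexify ST) p = 0}"


section \<open>Trek-matrices and the trek ideal\<close>

datatype 'v trek_col = SCol 'v | TCol 'v 'v

text \<open>The unordered pairs \<open>(\<ell>, m)\<close> are represented with \<open>\<ell> \<le> m\<close>.\<close>

definition trek_cols :: "('v::linorder \<times> 'v) set \<Rightarrow> 'v \<Rightarrow> 'v \<Rightarrow> 'v trek_col set" where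
  "trek_cols E i j =
     {SCol k | k. same_top E [i, k] [j, k]} \<union>
     {TCol l m | l m. l \<le> m \<and> same_top E [i, l, m] [j, l, m]}"

text \<open>\<open>trek_entry i c\<close> and \<open>trek_entry j c\<close> are the two entries of \<open>A\<^sub>i\<^sub>,\<^sub>j\<close> in column \<open>c\<close>.\<close>

fun trek_entry :: "'v::linorder \<Rightarrow> 'v trek_col \<Rightarrow> 'v moment_var cpoly" where
  "trek_entry i (SCol k) = svar i k"
| "trek_entry i (TCol l m) = tvar i l m"

text \<open>Each minor appears with both signs, since the two columns are taken in either order.\<close>

definition trek_minors :: "('v::linorder \<times> 'v) set \<Rightarrow> 'v \<Rightarrow> 'v \<Rightarrow> 'v moment_var cpoly set" where
  "trek_minors E i j =
     {trek_entry i c * trek_entry j d - trek_entry i d * trek_entry j c | c d.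
        c \<in> trek_cols E i j \<and> d \<in> trek_cols E i j \<and> c \<noteq> d}"

definition no_trek_vars :: "('v::linorder \<times> 'v) set \<Rightarrow> 'v moment_var cpoly set" where
  "no_trek_vars E =
     {svar i j | i j. \<not> trek_exists E [i, j]} \<union>
     {tvar i j k | i j k. \<not> trek_exists E [i, j, k]}"

definition trek_ideal :: "('v::linorder \<times> 'v) set \<Rightarrow> 'v moment_var cpoly set" where
  "trek_ideal E = ideal_gen (no_trek_vars E \<union> (\<Union>(i, j)\<in>E. trek_minors E i j))"

end

theory Submission
  imports Defs
begin

text \<open>
  Which treks share a top depends only on the sets of common ancestors: in a polytree every edge is a
  bridge, so a nonempty set of common ancestors has a lowest element, and this is the top of the simple trek.

  On the model, the row of \<open>j\<close> in \<open>A\<^sub>i\<^sub>,\<^sub>j\<close> is \<open>\<lambda>\<^sub>i\<^sub>j\<close> times the row of \<open>i\<close>, because every path from a common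
  ancestor to \<open>j\<close> runs through \<open>i\<close>. Conversely, the column \<open>(s\<^sub>i\<^sub>i, s\<^sub>j\<^sub>i)\<close> of \<open>A\<^sub>i\<^sub>,\<^sub>j\<close> and \<open>s\<^sub>i\<^sub>i > 0\<close> force
  \<open>\<lambda>\<^sub>i\<^sub>j = s\<^sub>i\<^sub>j / s\<^sub>i\<^sub>i\<close>, and with this choice the vanishing minors imply that multiplying \<open>S\<close> and \<open>T\<close> by
  \<open>I - \<Lambda>\<close> in the direction of \<open>j\<close> kills every entry at which \<open>j\<close> fails to reach some other index. By
  acyclicity the transformed \<open>S\<close> and \<open>T\<close> are therefore diagonal.

  For the linear generators, the model contains a torus orbit \<open>s\<^sub>i\<^sub>j = y\<^sub>i y\<^sub>j n\<^sub>i\<^sub>j\<close>, \<open>t\<^sub>i\<^sub>j\<^sub>k = y\<^sub>i y\<^sub>j y\<^sub>k n\<^sub>i\<^sub>j\<^sub>k\<close>, where the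
  \<open>n\<close> count common ancestors, and distinct monomials in \<open>y\<close> are linearly independent.
\<close>

section \<open>Common ancestors in polytrees\<close>

text \<open>These are the possible tops of treks between the listed vertices. Every vertex is its
  own ancestor, and only the set of list entries matters.\<close>

definition common_ancestors :: "('v \<times> 'v) set \<Rightarrow> 'v list \<Rightarrow> 'v set" where
  "common_ancestors E is = {a. \<forall>i\<in>set is. (a, i) \<in> E\<^sup>*}"

section \<open>Paths and treks as reachability\<close>

lemma rtrancl_imp_distinct_path:
  assumes "(x, y) \<in> R\<^sup>*"
  shows "\<exists>c. c \<noteq> [] \<and> hd c = x \<and> last c = y \<and> successively (\<lambda>a b. (a, b) \<in> R) c \<and> distinct c"
  using assms
proof (induction rule: converse_rtrancl_induct)
  case base
  show ?case by (rule exI[of _ "[y]"]) auto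
next
  case (step x z)
  then obtain c where c: "c \<noteq> []" "hd c = z" "last c = y"
      "successively (\<lambda>a b. (a, b) \<in> R) c" "distinct c"
    by blast
  show ?case
  proof (cases "x \<in> set c")
    \<comment> \<open>The path already visits \<open>x\<close>; cutting it down to its part from
      \<open>x\<close> on keeps it distinct.\<close>
    case True
    then obtain xs ys where "c = xs @ x # ys"
      by (auto simp: in_set_conv_decomp)
    with c show ?thesis
      by (intro exI[of _ "x # ys"]) (auto simp: successively_append_iff split: if_splits)
  next
    case False
    with c step(1) show ?thesis
      by (intro exI[of _ "x # c"]) (auto simp: successively_Cons)
  qed
qed

lemma directed_path_iff_rtrancl:
  "(\<exists>p. directed_path E p \<and> hd p = u \<and> last p = v) \<longleftrightarrow> (u, v) \<in> E\<^sup>*"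
proof
  assume "\<exists>p. directed_path E p \<and> hd p = u \<and> last p = v"
  then obtain p where "p \<noteq> []" "successively (\<lambda>u v. (u, v) \<in> E) p" "hd p = u" "last p = v"
    by (auto simp: directed_path_def)
  then show "(u, v) \<in> E\<^sup>*"
  proof (induction p arbitrary: u rule: induct_list012)
    case (3 x y zs)
    then have "(y, v) \<in> E\<^sup>*" "(x, y) \<in> E" "u = x"
      by auto
    then show ?case
      by (simp add: converse_rtrancl_into_rtrancl)
  qed auto
next
  assume "(u, v) \<in> E\<^sup>*"
  then show "\<exists>p. directed_path E p \<and> hd p = u \<and> last p = v"
    using rtrancl_imp_distinct_path unfolding directed_path_def by fast
qed

lemma directed_path_reaches:
  assumes "directed_path E p" "x \<in> set p"
  shows "(hd p, x) \<in> E\<^sup>*" "(x, last p) \<in> E\<^sup>*"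
proof -
  obtain xs ys where p: "p = xs @ x # ys"
    using assms(2) by (auto simp: in_set_conv_decomp)
  have "directed_path E (xs @ [x])" "directed_path E (x # ys)"
    using assms(1) unfolding p directed_path_def
    by (auto simp: successively_append_iff successively_Cons)
  moreover have "hd (xs @ [x]) = hd p" "last (x # ys) = last p"
    unfolding p by (cases xs; simp)+
  ultimately show "(hd p, x) \<in> E\<^sup>*" "(x, last p) \<in> E\<^sup>*"
    using directed_path_iff_rtrancl[of E] by (metis last_snoc, metis list.sel(1))
qed

lemma is_trek_paths:
  assumes "is_trek E is \<tau> v"
  shows "p \<in> set \<tau> \<Longrightarrow> \<exists>i\<in>set is. directed_path E p \<and> hd p = v \<and> last p = i"
    and "i \<in> set is \<Longrightarrow> \<exists>p\<in>set \<tau>. directed_path E p \<and> hd p = v \<and> last p = i"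
  using assms unfolding is_trek_def by (induction rule: list_all2_induct) auto

text \<open>Once the top is fixed, the paths of a trek can be chosen independently of each
  other.\<close>

lemma is_trek_iff_common_ancestor:
  "(\<exists>\<tau>. is_trek E is \<tau> v) \<longleftrightarrow> v \<in> common_ancestors E is"
proof (induction "is")
  case Nil
  show ?case by (simp add: is_trek_def common_ancestors_def)
next
  case (Cons i "is")
  have "(\<exists>\<tau>. is_trek E (i # is) \<tau> v) \<longleftrightarrow>
      (\<exists>p. directed_path E p \<and> hd p = v \<and> last p = i) \<and> (\<exists>\<tau>. is_trek E is \<tau> v)"
    by (auto simp: is_trek_def list_all2_Cons1)
  with Cons show ?case
    by (auto simp: directed_path_iff_rtrancl common_ancestors_def)
qed

lemma trek_exists_iff: "trek_exists E is \<longleftrightarrow> common_ancestors E is \<noteq> {}"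
  unfolding trek_exists_def by (subst ex_comm) (simp add: is_trek_iff_common_ancestor ex_in_conv)

section \<open>Bridges, parents and uniqueness of directed paths\<close>

lemma acyclic_reach_antisym:
  "acyclic E \<Longrightarrow> (u, v) \<in> E\<^sup>* \<Longrightarrow> (v, u) \<in> E\<^sup>* \<Longrightarrow> u = v"
  using acyclic_impl_antisym_rtrancl antisymD by metis

lemma polytree_acyclic: "polytree E \<Longrightarrow> acyclic E"
  by (simp add: polytree_def)

text \<open>A detour around the edge, made distinct, closes up with the edge itself to an undirected
  cycle.\<close>

lemma polytree_bridge:
  assumes E: "polytree E" and uv: "(u, v) \<in> E"
  shows "(u, v) \<notin> ((E - {(u, v)}) \<union> (E - {(u, v)})\<inverse>)\<^sup>*"
proof
  let ?R = "(E - {(u, v)}) \<union> (E - {(u, v)})\<inverse>"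
  assume "(u, v) \<in> ?R\<^sup>*"
  then obtain c where c: "c \<noteq> []" "hd c = u" "last c = v"
      "successively (\<lambda>a b. (a, b) \<in> ?R) c" "distinct c"
    using rtrancl_imp_distinct_path by metis
  have ac: "(v, u) \<notin> E\<^sup>*"
    using polytree_acyclic[OF E] uv by (meson acyclic_def rtrancl_into_trancl2)
  \<comment> \<open>Length 1 would be a loop and length 2 an edge antiparallel to
    \<open>(u, v)\<close>; acyclicity excludes both.\<close>
  have "length c \<noteq> 1"
    using c ac by (auto simp: length_Suc_conv)
  moreover have "length c \<noteq> 2"
    using c ac uv by (auto simp: length_Suc_conv numeral_2_eq_2)
  ultimately have "3 \<le> length c"
    using c(1) by (cases c; cases "tl c"; cases "tl (tl c)") auto
  moreover have "successively (\<lambda>a b. (a, b) \<in> E \<union> E\<inverse>) c"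
    by (rule successively_mono[OF c(4)]) auto
  ultimately have "undirected_cycle E c"
    using c uv by (simp add: undirected_cycle_def)
  then show False
    using E by (auto simp: polytree_def)
qed

lemma rtrancl_avoid_edge:
  assumes "(a, b) \<in> E\<^sup>*"
  shows "(a, b) \<in> (E - {(p, j)})\<^sup>* \<or> (a, p) \<in> E\<^sup>* \<and> (j, b) \<in> E\<^sup>*"
  using assms
proof (induction rule: rtrancl_induct)
  case (step y z)
  show ?case
  proof (cases "(y, z) = (p, j)")
    case True
    with step show ?thesis by auto
  next
    case False
    with step show ?thesis
      by (meson Diff_iff rtrancl.rtrancl_into_rtrancl singletonD)
  qed
qed simp

text \<open>Otherwise \<open>p \<leftarrow> a \<rightarrow> k \<leftarrow> b \<rightarrow> j\<close> would be a walk that bypasses the bridge \<open>p \<rightarrow> j\<close>.\<close>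

lemma polytree_reaches_parent:
  assumes E: "polytree E" and "(p, j) \<in> E"
    and "(a, p) \<in> E\<^sup>*" "(a, k) \<in> E\<^sup>*" "(b, j) \<in> E\<^sup>*" "(b, k) \<in> E\<^sup>*" "(j, k) \<notin> E\<^sup>*"
  shows "(b, p) \<in> E\<^sup>*"
proof (rule ccontr)
  assume nb: "(b, p) \<notin> E\<^sup>*"
  let ?F = "E - {(p, j)}"
  let ?R = "?F \<union> ?F\<inverse>"
  have "(j, p) \<notin> E\<^sup>*"
    using polytree_acyclic[OF E] assms(2) by (meson acyclic_def rtrancl_into_trancl2)
  \<comment> \<open>Using the edge \<open>(p, j)\<close> would make \<open>j\<close> reach
    \<open>p\<close> or \<open>k\<close> in the first two cases, and \<open>b\<close> reach
    \<open>p\<close> in the last two.\<close>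
  then have "(a, p) \<in> ?F\<^sup>*" "(a, k) \<in> ?F\<^sup>*" "(b, j) \<in> ?F\<^sup>*" "(b, k) \<in> ?F\<^sup>*"
    using rtrancl_avoid_edge[OF assms(3), of p j] rtrancl_avoid_edge[OF assms(4), of p j]
      rtrancl_avoid_edge[OF assms(5), of p j] rtrancl_avoid_edge[OF assms(6), of p j]
      assms(7) nb by blast+
  moreover have "?F\<^sup>* \<subseteq> ?R\<^sup>*"
    by (rule rtrancl_mono) blast
  moreover have "sym (?R\<^sup>*)"
    by (intro sym_rtrancl sym_Un_converse)
  ultimately have "(p, j) \<in> ?R\<^sup>*"
    by (meson rtrancl_trans subsetD symD)
  then show False
    using polytree_bridge[OF E assms(2)] by blast
qed

text \<open>By \<open>polytree_reaches_parent\<close>, with one parent as the vertex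
  \<open>k\<close> and also as the second source \<open>b\<close>, each parent reaches the other;
  acyclicity identifies them.\<close>

lemma polytree_unique_parent:
  assumes E: "polytree E" and pj: "(p, j) \<in> E" and qj: "(q, j) \<in> E"
    and ap: "(a, p) \<in> E\<^sup>*" and aq: "(a, q) \<in> E\<^sup>*"
  shows "p = q"
proof -
  have "(x, y) \<in> E \<Longrightarrow> (y, x) \<notin> E\<^sup>*" for x y
    using polytree_acyclic[OF E] by (meson acyclic_def rtrancl_into_trancl2)
  then have "(p, q) \<in> E\<^sup>*" "(q, p) \<in> E\<^sup>*"
    using polytree_reaches_parent[OF E pj ap aq _ _] polytree_reaches_parent[OF E qj aq ap _ _]
      pj qj by blast+
  then show ?thesis
    using acyclic_reach_antisym polytree_acyclic[OF E] by metis
qed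

text \<open>Directed paths are unique, so a vertex between the ends must lie on the given one. The
  induction peels off the last vertex: the path and any route through \<open>w\<close> enter it by
  the same parent.\<close>

lemma polytree_path_contains:
  assumes E: "polytree E" and "directed_path E p" "(hd p, w) \<in> E\<^sup>*" "(w, last p) \<in> E\<^sup>*"
  shows "w \<in> set p"
  using assms(2-)
proof (induction p rule: rev_induct)
  case Nil
  then show ?case by (simp add: directed_path_def)
next
  case (snoc i p)
  show ?case
  proof (cases "p = []")
    case True
    with snoc show ?thesis
      using acyclic_reach_antisym polytree_acyclic[OF E] by fastforce
  next
    case False
    with snoc have p: "directed_path E p" "(last p, i) \<in> E" "(hd p, w) \<in> E\<^sup>*"
      by (auto simp: directed_path_def successively_append_iff)
    show ?thesis
    proof (cases "w = i")
      case False
      then obtain q where q: "(w, q) \<in> E\<^sup>*" "(q, i) \<in> E"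
        using snoc.prems(3) by (metis last_snoc rtranclE)
      have "(hd p, last p) \<in> E\<^sup>*"
        using directed_path_reaches(1)[OF p(1)] \<open>p \<noteq> []\<close> by simp
      then have "q = last p"
        using polytree_unique_parent[OF E q(2) p(2)] p(3) q(1) by (meson rtrancl_trans)
      with q p snoc.IH show ?thesis by auto
    qed simp
  qed
qed

text \<open>A walk from \<open>v\<close> to \<open>i\<close> starts outside the descendants of
  \<open>a\<close> and ends inside, so some edge \<open>(u, x)\<close> of it enters them.\<close>

lemma reach_first_entry:
  assumes "(v, i) \<in> E\<^sup>*" "(a, i) \<in> E\<^sup>*" "(a, v) \<notin> E\<^sup>*"
  shows "\<exists>u x. (v, u) \<in> E\<^sup>* \<and> (u, x) \<in> E \<and> (a, x) \<in> E\<^sup>* \<and> (a, u) \<notin> E\<^sup>* \<and> (x, i) \<in> E\<^sup>*"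
  using assms
proof (induction rule: rtrancl_induct)
  case (step y z)
  show ?case
  proof (cases "(a, y) \<in> E\<^sup>*")
    case True
    then obtain u x where "(v, u) \<in> E\<^sup>*" "(u, x) \<in> E" "(a, x) \<in> E\<^sup>*" "(a, u) \<notin> E\<^sup>*" "(x, y) \<in> E\<^sup>*"
      using step by blast
    then show ?thesis
      using step(2) rtrancl.rtrancl_into_rtrancl by metis
  next
    case False
    then show ?thesis
      using step by blast
  qed
qed simp

section \<open>Tops as lowest common ancestors\<close>

definition lowest :: "('v \<times> 'v) set \<Rightarrow> 'v set \<Rightarrow> 'v \<Rightarrow> bool" where
  "lowest E A v \<longleftrightarrow> v \<in> A \<and> (\<forall>a\<in>A. (a, v) \<in> E\<^sup>*)"

text \<open>If some common ancestor \<open>a\<close> did not reach the maximal one \<open>v\<close>,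
  the edge \<open>(u, x)\<close> below \<open>v\<close> that enters the descendants of
  \<open>a\<close> would make \<open>x\<close> a common ancestor strictly below
  \<open>v\<close>.\<close>

lemma lowest_common_ancestorI:
  assumes E: "polytree E" and "is \<noteq> []" and v: "v \<in> common_ancestors E is"
    and max: "\<And>w. w \<in> common_ancestors E is \<Longrightarrow> (v, w) \<in> E\<^sup>* \<Longrightarrow> w = v"
  shows "lowest E (common_ancestors E is) v"
  unfolding lowest_def
proof (intro conjI ballI)
  fix a assume a: "a \<in> common_ancestors E is"
  show "(a, v) \<in> E\<^sup>*"
  proof (rule ccontr)
    assume av: "(a, v) \<notin> E\<^sup>*"
    obtain i where i: "i \<in> set is"
      using assms(2) by (cases "is") auto
    obtain u x where ux: "(v, u) \<in> E\<^sup>*" "(u, x) \<in> E" "(a, x) \<in> E\<^sup>*" "(a, u) \<notin> E\<^sup>*"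
      using reach_first_entry[OF _ _ av, of i] v a i by (auto simp: common_ancestors_def)
    \<comment> \<open>If \<open>x\<close> missed \<open>k\<close>, the two sources \<open>v\<close>
      and \<open>a\<close> would both reach \<open>k\<close>, and
      \<open>polytree_reaches_parent\<close> would put \<open>a\<close> above
      \<open>u\<close>.\<close>
    have "(x, k) \<in> E\<^sup>*" if "k \<in> set is" for k
      using polytree_reaches_parent[OF E ux(2) ux(1) _ ux(3)] ux(4) v a that
      by (auto simp: common_ancestors_def)
    then have "x \<in> common_ancestors E is"
      by (simp add: common_ancestors_def)
    then have "x = v"
      using max ux by (meson rtrancl.rtrancl_into_rtrancl)
    then show False
      using ux av by simp
  qed
qed (rule v)

text \<open>By uniqueness of paths, a common ancestor below the top lies on every path of the trek,
  which simplicity forbids. Conversely, a vertex on all paths is a common ancestor below the top,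
  and a lowest top leaves no second one.\<close>

lemma simple_trek_iff_lowest:
  assumes E: "polytree E" and "is \<noteq> []"
  shows "(\<exists>\<tau>. is_simple_trek E is \<tau> v) \<longleftrightarrow> lowest E (common_ancestors E is) v"
proof
  assume "\<exists>\<tau>. is_simple_trek E is \<tau> v"
  then obtain \<tau> where \<tau>: "is_trek E is \<tau> v" "(\<Inter>p\<in>set \<tau>. set p) = {v}"
    by (auto simp: is_simple_trek_def)
  show "lowest E (common_ancestors E is) v"
  proof (rule lowest_common_ancestorI[OF assms])
    show "v \<in> common_ancestors E is"
      using \<tau>(1) is_trek_iff_common_ancestor by fast
  next
    fix w assume w: "w \<in> common_ancestors E is" "(v, w) \<in> E\<^sup>*"
    have "w \<in> set p" if "p \<in> set \<tau>" for p
    proof -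
      obtain i where "i \<in> set is" "directed_path E p" "hd p = v" "last p = i"
        using is_trek_paths(1)[OF \<tau>(1) \<open>p \<in> set \<tau>\<close>] by blast
      then show ?thesis
        using polytree_path_contains[OF E, of p w] w by (simp add: common_ancestors_def)
    qed
    with \<tau>(2) show "w = v" by blast
  qed
next
  assume v: "lowest E (common_ancestors E is) v"
  then obtain \<tau> where \<tau>: "is_trek E is \<tau> v"
    using is_trek_iff_common_ancestor unfolding lowest_def by fast
  have "x = v" if x: "x \<in> (\<Inter>p\<in>set \<tau>. set p)" for x
  proof -
    have reach: "(v, x) \<in> E\<^sup>* \<and> (x, i) \<in> E\<^sup>*" if i: "i \<in> set is" for i
    proof -
      obtain p where "p \<in> set \<tau>" "directed_path E p" "hd p = v" "last p = i"
        using is_trek_paths(2)[OF \<tau> i] by blast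
      then show ?thesis
        using directed_path_reaches[of E p x] x by auto
    qed
    then have "(x, v) \<in> E\<^sup>*"
      using v by (simp add: lowest_def common_ancestors_def)
    moreover have "(v, x) \<in> E\<^sup>*"
      using assms(2) reach by (cases "is") auto
    ultimately show ?thesis
      using acyclic_reach_antisym polytree_acyclic[OF E] by metis
  qed
  moreover have "v \<in> set p" if "p \<in> set \<tau>" for p
    using is_trek_paths(1)[OF \<tau> that] by (auto simp: directed_path_def)
  ultimately have "(\<Inter>p\<in>set \<tau>. set p) = {v}"
    by auto
  with \<tau> show "\<exists>\<tau>. is_simple_trek E is \<tau> v"
    by (auto simp: is_simple_trek_def)
qed

text \<open>This shows that the description in \<open>top_of\<close> is well defined: finiteness and
  acyclicity give a maximal common ancestor, antisymmetry of reachability its uniqueness.\<close>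

lemma top_of_lowest:
  fixes E :: "('v::finite \<times> 'v) set"
  assumes E: "polytree E" and "is \<noteq> []" and tr: "trek_exists E is"
  shows "lowest E (common_ancestors E is) (top_of E is)"
proof -
  have "wf (E\<inverse>)"
    using finite_acyclic_wf_converse[OF finite polytree_acyclic[OF E]] .
  then have "wf ((E\<inverse>)\<^sup>+)"
    by (rule wf_trancl)
  then obtain v where v: "v \<in> common_ancestors E is"
      and "\<And>w. (w, v) \<in> (E\<inverse>)\<^sup>+ \<Longrightarrow> w \<notin> common_ancestors E is"
    using tr wfE_min[of "(E\<inverse>)\<^sup>+"] unfolding trek_exists_iff by (metis ex_in_conv)
  then have "lowest E (common_ancestors E is) v"
    by (intro lowest_common_ancestorI[OF assms(1,2)])
      (auto simp: trancl_converse rtrancl_eq_or_trancl)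
  moreover have "u = v" if "lowest E (common_ancestors E is) u" for u
    using that calculation acyclic_reach_antisym[OF polytree_acyclic[OF E]]
    by (auto simp: lowest_def)
  ultimately show ?thesis
    unfolding top_of_def simple_trek_iff_lowest[OF assms(1,2)] by (rule theI)
qed

lemma same_topI:
  assumes "polytree E" "is \<noteq> []" "js \<noteq> []"
    and "common_ancestors E is = common_ancestors E js" "common_ancestors E is \<noteq> {}"
  shows "same_top E is js"
  using assms simple_trek_iff_lowest[OF assms(1)]
  by (simp add: same_top_def trek_exists_iff top_of_def)

text \<open>The common ancestor \<open>a\<close> reaches the shared top, which in turn reaches
  \<open>i\<close>.\<close>

lemma same_top_reaches:
  fixes E :: "('v::finite \<times> 'v) set"
  assumes "polytree E" "same_top E (i # is) (j # is)" "a \<in> common_ancestors E (j # is)"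
  shows "(a, i) \<in> E\<^sup>*"
proof -
  have "lowest E (common_ancestors E (i # is)) (top_of E (j # is))"
      "lowest E (common_ancestors E (j # is)) (top_of E (j # is))"
    using top_of_lowest[OF assms(1)] assms(2) unfolding same_top_def by (metis list.distinct(1))+
  then show ?thesis
    using assms(3) by (auto simp: lowest_def common_ancestors_def intro: rtrancl_trans)
qed

text \<open>When \<open>j\<close> does not reach all other vertices, a common ancestor has to pass
  through the parent \<open>p\<close>. This is what produces columns of the trek-matrix of
  \<open>(p, j)\<close>.\<close>

lemma common_ancestors_parent:
  assumes E: "polytree E" and pj: "(p, j) \<in> E" and ne: "common_ancestors E (p # is) \<noteq> {}"
    and nr: "\<exists>k\<in>set is. (j, k) \<notin> E\<^sup>*"
  shows "common_ancestors E (j # is) = common_ancestors E (p # is)"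
proof -
  obtain a where a: "a \<in> common_ancestors E (p # is)"
    using ne by blast
  obtain k where k: "k \<in> set is" "(j, k) \<notin> E\<^sup>*"
    using nr by blast
  have "(b, p) \<in> E\<^sup>*" if "b \<in> common_ancestors E (j # is)" for b
    using polytree_reaches_parent[OF E pj, of a k b] a that k by (auto simp: common_ancestors_def)
  with pj show ?thesis
    by (auto simp: common_ancestors_def)
qed

section \<open>Evaluation of polynomials and generated ideals\<close>

text \<open>The monomial factor inside \<open>peval\<close>, split off so that its multiplicativity
  can be used by itself.\<close>

definition meval :: "('x \<Rightarrow> complex) \<Rightarrow> ('x \<Rightarrow>\<^sub>0 nat) \<Rightarrow> complex" where
  "meval a m = (\<Prod>x\<in>Poly_Mapping.keys m. a x ^ Poly_Mapping.lookup m x)"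

lemma meval_superset:
  "finite A \<Longrightarrow> Poly_Mapping.keys m \<subseteq> A \<Longrightarrow> meval a m = (\<Prod>x\<in>A. a x ^ Poly_Mapping.lookup m x)"
  unfolding meval_def by (rule prod.mono_neutral_left) (auto simp: in_keys_iff)

lemma meval_add: "meval a (m + n) = meval a m * meval a n"
proof -
  let ?A = "Poly_Mapping.keys m \<union> Poly_Mapping.keys n"
  have "Poly_Mapping.keys (m + n) \<subseteq> ?A"
    by (rule keys_add)
  then show ?thesis
    by (simp add: meval_superset[of ?A] lookup_add power_add prod.distrib)
qed

lemma meval_single [simp]: "meval a (Poly_Mapping.single x n) = a x ^ n"
  by (subst meval_superset[of "{x}"]) auto

lemma meval_zero [simp]: "meval a 0 = 1"
  by (simp add: meval_def)

lemma peval_superset: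
  "finite A \<Longrightarrow> Poly_Mapping.keys p \<subseteq> A \<Longrightarrow> peval a p = (\<Sum>m\<in>A. Poly_Mapping.lookup p m * meval a m)"
  unfolding peval_def meval_def[symmetric]
  by (rule sum.mono_neutral_left) (auto simp: in_keys_iff)

lemma peval_zero [simp]: "peval a 0 = 0"
  by (simp add: peval_def)

lemma peval_single: "peval a (Poly_Mapping.single m c) = c * meval a m"
  by (subst peval_superset[of "{m}"]) auto

lemma peval_pvar [simp]: "peval a (pvar x) = a x"
  by (simp add: pvar_def peval_single)

lemma peval_add: "peval a (p + q) = peval a p + peval a q"
proof -
  let ?A = "Poly_Mapping.keys p \<union> Poly_Mapping.keys q"
  have "Poly_Mapping.keys (p + q) \<subseteq> ?A"
    by (rule keys_add)
  then show ?thesis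
    by (simp add: peval_superset[of ?A] lookup_add distrib_right sum.distrib)
qed

lemma peval_uminus: "peval a (- p) = - peval a p"
  using peval_add[of a p "- p"] by (simp add: eq_neg_iff_add_eq_0 add.commute)

lemma peval_diff: "peval a (p - q) = peval a p - peval a q"
  using peval_add[of a p "- q"] by (simp add: peval_uminus)

lemma peval_sum: "peval a (\<Sum>i\<in>I. f i) = (\<Sum>i\<in>I. peval a (f i))"
  by (induction I rule: infinite_finite_induct) (auto simp: peval_add)

lemma poly_mapping_sum_single:
  "p = (\<Sum>m\<in>Poly_Mapping.keys p. Poly_Mapping.single m (Poly_Mapping.lookup p m))"
  by (rule poly_mapping_eqI)
    (auto simp: lookup_sum lookup_single when_def in_keys_iff sum.delta' cong: if_cong)

lemma peval_mult: "peval a (p * q) = peval a p * peval a q"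
proof -
  let ?s = "\<lambda>p m. Poly_Mapping.single m (Poly_Mapping.lookup p m)"
  have "peval a (p * q) = peval a ((\<Sum>m\<in>Poly_Mapping.keys p. ?s p m) * (\<Sum>n\<in>Poly_Mapping.keys q. ?s q n))"
    by (simp add: poly_mapping_sum_single[symmetric])
  also have "\<dots> = (\<Sum>m\<in>Poly_Mapping.keys p. peval a (?s p m)) * (\<Sum>n\<in>Poly_Mapping.keys q. peval a (?s q n))"
    by (simp add: sum_product peval_sum mult_single peval_single meval_add mult_ac)
  also have "\<dots> = peval a p * peval a q"
    by (simp add: peval_sum[symmetric] poly_mapping_sum_single[symmetric])
  finally show ?thesis .
qed

section \<open>Generated ideals and linear polynomials\<close>

lemma is_ideal_ideal_gen: "is_ideal (ideal_gen B)"
  unfolding ideal_gen_def by (rule hull_in) (auto simp: is_ideal_def)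

lemma ideal_gen_incl: "B \<subseteq> ideal_gen B"
  unfolding ideal_gen_def by (rule hull_subset)

lemma ideal_gen_minimal: "B \<subseteq> I \<Longrightarrow> is_ideal I \<Longrightarrow> ideal_gen B \<subseteq> I"
  unfolding ideal_gen_def by (rule hull_minimal)

lemma ideal_sum_mult:
  assumes "is_ideal I" "\<And>x. x \<in> A \<Longrightarrow> f x \<in> I"
  shows "(\<Sum>x\<in>A. r x * f x) \<in> I"
  using assms(2)
  by (induction A rule: infinite_finite_induct) (use assms(1) in \<open>auto simp: is_ideal_def\<close>)

lemma is_ideal_vanishing: "is_ideal {p. \<forall>a\<in>A. peval a p = 0}"
  by (auto simp: is_ideal_def peval_add peval_mult)

text \<open>The polynomials that vanish at \<open>a\<close> form an ideal, so the generators
  decide.\<close>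

lemma vanishing_ideal_gen:
  "(\<forall>p\<in>ideal_gen B. peval a p = 0) \<longleftrightarrow> (\<forall>p\<in>B. peval a p = 0)"
  using ideal_gen_incl[of B] ideal_gen_minimal[of B "{p. \<forall>b\<in>{a}. peval b p = 0}"]
    is_ideal_vanishing[of "{a}"] by auto

text \<open>The case \<open>m = 0\<close> is present because \<open>linear_poly\<close> admits a
  constant term.\<close>

lemma linear_poly_keys:
  assumes "linear_poly p" "m \<in> Poly_Mapping.keys p"
  shows "m = 0 \<or> (\<exists>x. m = Poly_Mapping.single x 1)"
proof (rule disjCI)
  let ?K = "Poly_Mapping.keys m"
  assume "\<nexists>x. m = Poly_Mapping.single x 1"
  show "m = 0"
  proof (rule ccontr)
    assume "m \<noteq> 0"
    then obtain x where x: "x \<in> ?K"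
      by (auto simp: in_keys_iff poly_mapping_eq_iff fun_eq_iff)
    have "(\<Sum>y\<in>?K. Poly_Mapping.lookup m y) \<le> 1"
      using assms by (auto simp: linear_poly_def)
    then have le: "Poly_Mapping.lookup m x + (\<Sum>y\<in>?K - {x}. Poly_Mapping.lookup m y) \<le> 1"
      using x by (simp add: sum.remove)
    moreover have "Poly_Mapping.lookup m x \<noteq> 0"
      using x by (simp add: in_keys_iff)
    ultimately have lx: "Poly_Mapping.lookup m x = 1"
        and "(\<Sum>y\<in>?K - {x}. Poly_Mapping.lookup m y) = 0"
      by linarith+
    then have "\<And>y. y \<noteq> x \<Longrightarrow> Poly_Mapping.lookup m y = 0"
      by (auto simp: in_keys_iff)
    with lx have "m = Poly_Mapping.single x 1"
      by (intro poly_mapping_eqI) (auto simp: lookup_single when_def)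
    with \<open>\<nexists>x. m = Poly_Mapping.single x 1\<close> show False by blast
  qed
qed

lemma linear_poly_pvar: "linear_poly (pvar x)"
  by (simp add: linear_poly_def pvar_def)

section \<open>Independence of monomials on the positive orthant\<close>

text \<open>Dedekind's argument for the linear independence of characters, on a set \<open>Y\<close>
  closed under the operation \<open>f\<close>.\<close>

lemma characters_independent:
  fixes \<phi> :: "'m \<Rightarrow> 'y \<Rightarrow> complex"
  assumes "finite M"
    and closed: "\<And>y z. y \<in> Y \<Longrightarrow> z \<in> Y \<Longrightarrow> f y z \<in> Y"
    and mult: "\<And>m y z. m \<in> M \<Longrightarrow> y \<in> Y \<Longrightarrow> z \<in> Y \<Longrightarrow> \<phi> m (f y z) = \<phi> m y * \<phi> m z"
    and nz: "e \<in> Y" "\<And>m. m \<in> M \<Longrightarrow> \<phi> m e \<noteq> 0"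
    and dist: "\<And>m n. m \<in> M \<Longrightarrow> n \<in> M \<Longrightarrow> m \<noteq> n \<Longrightarrow> \<exists>y\<in>Y. \<phi> m y \<noteq> \<phi> n y"
    and vanish: "\<And>y. y \<in> Y \<Longrightarrow> (\<Sum>m\<in>M. c m * \<phi> m y) = 0"
    and "m \<in> M"
  shows "c m = 0"
  using assms(1) mult nz(2) dist vanish \<open>m \<in> M\<close>
proof (induction M arbitrary: c m rule: finite_induct)
  case (insert k M)
  have other: "c n = 0" if n: "n \<in> M" for n
  proof -
    have "n \<noteq> k" using n insert.hyps by blast
    then obtain z where z: "z \<in> Y" "\<phi> n z \<noteq> \<phi> k z"
      using insert.prems(3)[of n k] n by auto
    have "(\<Sum>m\<in>M. (c m * (\<phi> m z - \<phi> k z)) * \<phi> m y) = 0" if y: "y \<in> Y" for y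
    proof -
      \<comment> \<open>The relation at \<open>f y z\<close> minus \<open>\<phi> k z\<close> times
        the relation at \<open>y\<close> loses the term of \<open>k\<close>.\<close>
      have "0 = (\<Sum>m\<in>insert k M. c m * \<phi> m (f y z)) - \<phi> k z * (\<Sum>m\<in>insert k M. c m * \<phi> m y)"
        using insert.prems(4) closed y z by simp
      also have "\<dots> = (\<Sum>m\<in>insert k M. (c m * (\<phi> m z - \<phi> k z)) * \<phi> m y)"
        unfolding sum_distrib_left sum_subtractf[symmetric]
        by (rule sum.cong) (auto simp: insert.prems(1) y z algebra_simps)
      also have "\<dots> = (\<Sum>m\<in>M. (c m * (\<phi> m z - \<phi> k z)) * \<phi> m y)"
        using insert.hyps by simp
      finally show ?thesis by simp
    qed
    then have "c n * (\<phi> n z - \<phi> k z) = 0"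
      using insert.IH[of "\<lambda>m. c m * (\<phi> m z - \<phi> k z)" n] insert.prems(1-3) n by auto
    then show ?thesis using z by simp
  qed
  then have "c k * \<phi> k e = 0"
    using insert.prems(4)[OF nz(1)] insert.hyps by simp
  then show ?case
    using other insert.prems(2)[of k] insert.prems(5) by auto
qed simp

text \<open>Monomials are characters of the positive orthant under componentwise multiplication; a
  sorted list is determined by its multiset, that is, by its exponents.\<close>

lemma sorted_monomials_independent:
  fixes L :: "'m \<Rightarrow> 'v::linorder list" and c :: "'m \<Rightarrow> complex"
  assumes "finite M" "inj_on L M" "\<And>m. m \<in> M \<Longrightarrow> sorted (L m)"
    and vanish: "\<And>y. (\<And>i. y i > (0::real)) \<Longrightarrow> (\<Sum>m\<in>M. c m * of_real (\<Prod>i\<leftarrow>L m. y i)) = 0"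
    and "m \<in> M"
  shows "c m = 0"
proof (rule characters_independent[where Y = "{y. \<forall>i. y i > (0::real)}" and c = c
      and \<phi> = "\<lambda>m y. of_real (\<Prod>i\<leftarrow>L m. y i)" and e = "\<lambda>_. 1" and f = "\<lambda>y z i. y i * z i"])
  have prod_list_mult: "(\<Prod>i\<leftarrow>is. y i * z i) = (\<Prod>i\<leftarrow>is. y i) * (\<Prod>i\<leftarrow>is. z i)"
      for y z :: "'v \<Rightarrow> real" and "is" :: "'v list"
    by (induction "is") auto
  then show "\<And>m y z. complex_of_real (\<Prod>i\<leftarrow>L m. y i * z i)
      = of_real (\<Prod>i\<leftarrow>L m. y i) * of_real (\<Prod>i\<leftarrow>L m. z i)"
    by (simp add: prod_list_mult)
  have one: "(\<Prod>i\<leftarrow>is. 1) = (1::real)" for "is" :: "'v list"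
    by (induction "is") auto
  then show "\<And>m. complex_of_real (\<Prod>i\<leftarrow>L m. 1) \<noteq> 0"
    by simp
  fix m n assume mn: "m \<in> M" "n \<in> M" "m \<noteq> n"
  then have "L m \<noteq> L n"
    using assms(2) by (auto dest: inj_onD)
  then have "mset (L m) \<noteq> mset (L n)"
    using assms(3) mn by (metis properties_for_sort)
  then obtain i where i: "count (mset (L m)) i \<noteq> count (mset (L n)) i"
    by (auto simp: multiset_eq_iff)
  \<comment> \<open>With the value 2 in coordinate \<open>i\<close> and 1 elsewhere, a monomial
    evaluates to 2 to the power of its exponent at \<open>i\<close>.\<close>
  let ?y = "\<lambda>k. if k = i then 2 else 1 :: real"
  have "(\<Prod>k\<leftarrow>is. ?y k) = 2 ^ count (mset is) i" for "is"
    by (induction "is") auto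
  then have "(\<Prod>k\<leftarrow>L m. ?y k) \<noteq> (\<Prod>k\<leftarrow>L n. ?y k)"
    using i by (simp add: power_inject_exp)
  then show "\<exists>y\<in>{y. \<forall>i. y i > 0}.
      complex_of_real (\<Prod>i\<leftarrow>L m. y i) \<noteq> of_real (\<Prod>i\<leftarrow>L n. y i)"
    unfolding of_real_eq_iff by (intro bexI[of _ ?y]) auto
qed (use assms in auto)

section \<open>The path matrix\<close>

lemma sum_Kronecker: "(\<Sum>a\<in>UNIV. f a * (if a = i then 1 else 0)) = (f i :: real)"
  "(\<Sum>a\<in>UNIV. f a * (if i = a then 1 else 0)) = (f i :: real)"
  for i :: "'v::finite"
  by (simp_all add: if_distrib cong: if_cong)

context
  fixes E :: "('v::finite \<times> 'v) set" and \<Lambda> :: "(real, 'v) matrix2"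
  assumes acyclic: "acyclic E" and \<Lambda>: "\<Lambda> \<in> edge_matrices E"
begin

lemma edge_matrix_outside: "(i, j) \<notin> E \<Longrightarrow> \<Lambda> $ i $ j = 0"
  using \<Lambda> by (simp add: edge_matrices_def)

text \<open>A kernel vector has each entry as a combination of the entries at its children, so it
  vanishes by induction starting from the sinks.\<close>

lemma invertible_one_minus: "invertible (mat 1 - \<Lambda>)"
proof -
  have "x = 0" if x: "(mat 1 - \<Lambda>) *v x = 0" for x
  proof -
    have eq: "x $ i = (\<Sum>j\<in>UNIV. \<Lambda> $ i $ j * x $ j)" for i
    proof -
      have "((mat 1 - \<Lambda>) *v x) $ i = x $ i - (\<Sum>j\<in>UNIV. \<Lambda> $ i $ j * x $ j)"
        by (simp add: matrix_vector_mult_diff_rdistrib matrix_vector_mult_def[of \<Lambda>])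
      with x show ?thesis by simp
    qed
    have "x $ i = 0" for i
    proof (induction i rule: wf_induct_rule[OF finite_acyclic_wf_converse[OF finite acyclic]])
      case (1 i)
      then have "\<Lambda> $ i $ j * x $ j = 0" for j
        using edge_matrix_outside[of i j] by (cases "(i, j) \<in> E") auto
      then show ?case
        by (subst eq) (intro sum.neutral, simp)
    qed
    then show ?thesis
      by (simp add: vec_eq_iff)
  qed
  then show ?thesis
    using matrix_left_invertible_ker invertible_left_inverse by blast
qed

lemma path_matrix_inverse:
  "matrix_inv (mat 1 - \<Lambda>) ** (mat 1 - \<Lambda>) = mat 1"
  "(mat 1 - \<Lambda>) ** matrix_inv (mat 1 - \<Lambda>) = mat 1"
  using someI_ex[OF invertible_one_minus[unfolded invertible_def]]
  by (simp_all add: matrix_inv_def)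

text \<open>A path from \<open>a\<close> to \<open>j\<close> is empty or ends with an edge
  \<open>(p, j)\<close>; algebraically, this is the product of the inverse with
  \<open>mat 1 - \<Lambda>\<close>.\<close>

lemma path_matrix_rec:
  "matrix_inv (mat 1 - \<Lambda>) $ a $ j = (if a = j then 1 else 0)
    + (\<Sum>p\<in>UNIV. matrix_inv (mat 1 - \<Lambda>) $ a $ p * \<Lambda> $ p $ j)"
proof -
  let ?B = "matrix_inv (mat 1 - \<Lambda>)"
  have "(if a = j then 1 else 0) = (mat 1 :: (real, 'v) matrix2) $ a $ j"
    by (simp add: mat_def)
  also have "\<dots> = (?B ** (mat 1 - \<Lambda>)) $ a $ j"
    by (simp add: path_matrix_inverse)
  also have "\<dots> = ?B $ a $ j - (\<Sum>p\<in>UNIV. ?B $ a $ p * \<Lambda> $ p $ j)"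
    by (simp add: matrix_matrix_mult_def mat_def right_diff_distrib sum_subtractf sum_Kronecker)
  finally show ?thesis by simp
qed

lemma path_matrix_support: "(a, i) \<notin> E\<^sup>* \<Longrightarrow> matrix_inv (mat 1 - \<Lambda>) $ a $ i = 0"
proof (induction i rule: wf_induct_rule[OF finite_acyclic_wf[OF finite acyclic]])
  case (1 i)
  have "matrix_inv (mat 1 - \<Lambda>) $ a $ p * \<Lambda> $ p $ i = 0" for p
  proof (cases "(p, i) \<in> E")
    case True
    then have "(a, p) \<notin> E\<^sup>*"
      using 1(2) rtrancl_into_rtrancl by metis
    with True 1(1) show ?thesis by simp
  qed (simp add: edge_matrix_outside)
  moreover have "a \<noteq> i" using 1 by auto
  ultimately show ?case
    by (subst path_matrix_rec) (simp add: sum.neutral)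
qed

lemma path_matrix_diag: "matrix_inv (mat 1 - \<Lambda>) $ a $ a = 1"
proof -
  have "matrix_inv (mat 1 - \<Lambda>) $ a $ p * \<Lambda> $ p $ a = 0" for p
  proof (cases "(p, a) \<in> E")
    case True
    then have "(a, p) \<notin> E\<^sup>*"
      using acyclic by (auto simp: acyclic_def dest: rtrancl_into_trancl1)
    then show ?thesis by (simp add: path_matrix_support)
  qed (simp add: edge_matrix_outside)
  then show ?thesis
    by (subst path_matrix_rec) (simp add: sum.neutral)
qed

text \<open>In the recursion, only parents of \<open>j\<close> below \<open>a\<close> contribute,
  and \<open>i\<close> is the only such parent.\<close>

lemma path_matrix_edge:
  assumes "polytree E" "(a, i) \<in> E\<^sup>*" "(i, j) \<in> E"
  shows "matrix_inv (mat 1 - \<Lambda>) $ a $ j = \<Lambda> $ i $ j * matrix_inv (mat 1 - \<Lambda>) $ a $ i"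
proof -
  let ?B = "matrix_inv (mat 1 - \<Lambda>)"
  have "?B $ a $ p * \<Lambda> $ p $ j = 0" if "p \<noteq> i" for p
  proof -
    have "(a, p) \<notin> E\<^sup>* \<or> (p, j) \<notin> E"
      using polytree_unique_parent[OF assms(1) _ assms(3) _ assms(2), of p] that by blast
    then show ?thesis
      using path_matrix_support edge_matrix_outside by auto
  qed
  then have "(\<Sum>p\<in>UNIV - {i}. ?B $ a $ p * \<Lambda> $ p $ j) = 0"
    by (intro sum.neutral ballI) blast
  then have "(\<Sum>p\<in>UNIV. ?B $ a $ p * \<Lambda> $ p $ j) = ?B $ a $ i * \<Lambda> $ i $ j"
    by (subst sum.remove[of _ i]) auto
  moreover have "a \<noteq> j"
    using assms acyclic by (metis acyclic_def rtrancl_into_trancl1)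
  ultimately show ?thesis
    by (subst path_matrix_rec) simp
qed

end

section \<open>Congruence and Tucker transformations\<close>

lemma congruence_nth:
  "(transpose M ** S ** M) $ i $ j = (\<Sum>b\<in>UNIV. M $ b $ j * (\<Sum>a\<in>UNIV. M $ a $ i * S $ a $ b))"
  for M S :: "(real, 'v::finite) matrix2"
  by (simp add: matrix_matrix_mult_def transpose_def mult.commute)

lemma congruence_diagonal:
  fixes B \<Omega> :: "(real, 'v::finite) matrix2"
  assumes "diagonal_matrix \<Omega>"
  shows "(transpose B ** \<Omega> ** B) $ i $ j = (\<Sum>a\<in>UNIV. \<Omega> $ a $ a * B $ a $ i * B $ a $ j)"
proof -
  have "(\<Sum>a\<in>UNIV. B $ a $ i * \<Omega> $ a $ b) = B $ b $ i * \<Omega> $ b $ b" for b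
    using assms by (subst sum.remove[of _ b]) (auto simp: diagonal_matrix_def intro!: sum.neutral)
  then show ?thesis
    by (simp add: congruence_nth mult_ac)
qed

text \<open>The quadratic form of the product at \<open>x\<close> is that of \<open>S\<close> at
  \<open>M *v x\<close>, which is nonzero for nonzero \<open>x\<close>.\<close>

lemma congruence_PD:
  fixes S M :: "(real, 'v::finite) matrix2"
  assumes "S \<in> PD" "invertible M"
  shows "transpose M ** S ** M \<in> PD"
  unfolding PD_def
proof (intro CollectI conjI allI impI)
  show "sym_matrix (transpose M ** S ** M)"
    using assms(1) by (simp add: PD_def sym_matrix_def matrix_transpose_mul matrix_mul_assoc)
next
  fix x :: "real ^ 'v" assume "x \<noteq> 0"
  then have "M *v x \<noteq> 0"
    using assms(2) matrix_left_invertible_ker invertible_left_inverse by blast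
  then have "0 < (M *v x) \<bullet> (S *v (M *v x))"
    using assms(1) by (simp add: PD_def)
  also have "\<dots> = x \<bullet> ((transpose M ** S ** M) *v x)"
    by (simp add: matrix_vector_mul_assoc[symmetric]) (metis dot_lmul_matrix inner_commute)
  finally show "0 < x \<bullet> ((transpose M ** S ** M) *v x)" .
qed

lemma PD_sym: "S \<in> PD \<Longrightarrow> S $ i $ j = S $ j $ i"
  by (metis (mono_tags, lifting) PD_def mem_Collect_eq sym_matrix_def transpose_def vec_lambda_beta)

lemma PD_diag_pos:
  fixes S :: "(real, 'v::finite) matrix2"
  assumes "S \<in> PD"
  shows "0 < S $ i $ i"
proof -
  have "axis i 1 \<noteq> (0 :: real ^ 'v)" by simp
  then have "0 < axis i 1 \<bullet> (S *v axis i 1)"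
    using assms by (auto simp: PD_def)
  then show ?thesis
    by (simp add: inner_axis' matrix_vector_mul_component inner_axis)
qed

lemma diagonal_PD:
  fixes w :: "'v::finite \<Rightarrow> real"
  assumes "\<And>i. 0 < w i"
  shows "(\<chi> i j. if i = j then w i else 0) \<in> PD"
  unfolding PD_def
proof (intro CollectI conjI allI impI)
  let ?S = "\<chi> i j. if i = j then w i else 0"
  show "sym_matrix ?S"
    by (auto simp: sym_matrix_def transpose_def vec_eq_iff)
  fix x :: "real ^ 'v" assume "x \<noteq> 0"
  then obtain k where k: "x $ k \<noteq> 0" by (auto simp: vec_eq_iff)
  have "x \<bullet> (?S *v x) = (\<Sum>i\<in>UNIV. w i * (x $ i)\<^sup>2)"
    by (simp add: inner_vec_def matrix_vector_mult_def if_distrib if_distribR power2_eq_square mult_ac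
        cong: if_cong)
  moreover have "0 < (\<Sum>i\<in>UNIV. w i * (x $ i)\<^sup>2)"
    using assms k by (intro sum_pos2[of _ k]) (auto simp: less_imp_le)
  ultimately show "0 < x \<bullet> (?S *v x)" by simp
qed

section \<open>Tucker products of third-order tensors\<close>

lemma tucker_diagonal:
  fixes B :: "(real, 'v::finite) matrix2"
  assumes "diagonal_tensor \<Omega>"
  shows "tucker \<Omega> B $ i $ j $ k = (\<Sum>a\<in>UNIV. \<Omega> $ a $ a $ a * B $ a $ i * B $ a $ j * B $ a $ k)"
proof -
  have "(\<Sum>b\<in>UNIV. \<Sum>c\<in>UNIV. \<Omega> $ a $ b $ c * B $ a $ i * B $ b $ j * B $ c $ k)
      = \<Omega> $ a $ a $ a * B $ a $ i * B $ a $ j * B $ a $ k" for a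
  proof -
    have "(\<Sum>c\<in>UNIV. \<Omega> $ a $ b $ c * B $ a $ i * B $ b $ j * B $ c $ k) = 0" if "b \<noteq> a" for b
      using assms that by (auto simp: diagonal_tensor_def intro!: sum.neutral)
    then have "(\<Sum>b\<in>UNIV. \<Sum>c\<in>UNIV. \<Omega> $ a $ b $ c * B $ a $ i * B $ b $ j * B $ c $ k)
        = (\<Sum>c\<in>UNIV. \<Omega> $ a $ a $ c * B $ a $ i * B $ a $ j * B $ c $ k)"
      by (subst sum.remove[of _ a]) auto
    also have "\<dots> = \<Omega> $ a $ a $ a * B $ a $ i * B $ a $ j * B $ a $ k"
      using assms by (subst sum.remove[of _ a]) (auto simp: diagonal_tensor_def intro!: sum.neutral)
    finally show ?thesis .
  qed
  then show ?thesis by (simp add: tucker_def)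
qed

text \<open>The sum over the first index is placed innermost, because elimination along the edges
  makes exactly this sum vanish.\<close>

lemma tucker_nth:
  "tucker T M $ i $ j $ k =
    (\<Sum>b\<in>UNIV. \<Sum>c\<in>UNIV. M $ b $ j * M $ c $ k * (\<Sum>a\<in>UNIV. M $ a $ i * T $ a $ b $ c))"
  for M :: "(real, 'v::finite) matrix2"
proof -
  have "tucker T M $ i $ j $ k = (\<Sum>a\<in>UNIV. \<Sum>b\<in>UNIV. \<Sum>c\<in>UNIV.
      M $ b $ j * M $ c $ k * (M $ a $ i * T $ a $ b $ c))"
    by (simp add: tucker_def mult_ac)
  also have "\<dots> = (\<Sum>b\<in>UNIV. \<Sum>a\<in>UNIV. \<Sum>c\<in>UNIV.
      M $ b $ j * M $ c $ k * (M $ a $ i * T $ a $ b $ c))"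
    by (rule sum.swap)
  also have "\<dots> = (\<Sum>b\<in>UNIV. \<Sum>c\<in>UNIV. \<Sum>a\<in>UNIV.
      M $ b $ j * M $ c $ k * (M $ a $ i * T $ a $ b $ c))"
    by (intro sum.cong refl sum.swap)
  finally show ?thesis
    by (simp add: sum_distrib_left)
qed

text \<open>With a single sum over triples, one exchange of summations suffices to compose two
  Tucker products.\<close>

lemma tucker_triple:
  "tucker T M $ i $ j $ k = (\<Sum>(a, b, c)\<in>UNIV. T $ a $ b $ c * M $ a $ i * M $ b $ j * M $ c $ k)"
  for M :: "(real, 'v::finite) matrix2"
  by (simp add: tucker_def sum.cartesian_product case_prod_unfold)

lemma sum_product3:
  fixes f g h :: "'v \<Rightarrow> real"
  shows "(\<Sum>a\<in>A. f a) * (\<Sum>b\<in>B. g b) * (\<Sum>c\<in>C. h c) = (\<Sum>a\<in>A. \<Sum>b\<in>B. \<Sum>c\<in>C. f a * g b * h c)"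
proof -
  have "(\<Sum>a\<in>A. f a) * (\<Sum>b\<in>B. g b) * (\<Sum>c\<in>C. h c) = (\<Sum>a\<in>A. f a * (\<Sum>b\<in>B. g b * (\<Sum>c\<in>C. h c)))"
    by (simp only: mult.assoc sum_distrib_right)
  also have "\<dots> = (\<Sum>a\<in>A. \<Sum>b\<in>B. \<Sum>c\<in>C. f a * g b * h c)"
    by (simp only: sum_distrib_left mult.assoc)
  finally show ?thesis .
qed

lemma tucker_tucker:
  fixes M B :: "(real, 'v::finite) matrix2"
  shows "tucker (tucker T M) B = tucker T (M ** B)"
proof -
  have "tucker (tucker T M) B $ i $ j $ k = tucker T (M ** B) $ i $ j $ k" for i j k
  proof -
    have *: "(\<Sum>(a, b, c)\<in>UNIV. M $ x $ a * M $ y $ b * M $ z $ c * (B $ a $ i * B $ b $ j * B $ c $ k))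
        = (M ** B) $ x $ i * (M ** B) $ y $ j * (M ** B) $ z $ k" for x y z
    proof -
      have "(M ** B) $ x $ i * (M ** B) $ y $ j * (M ** B) $ z $ k = (\<Sum>a\<in>UNIV. \<Sum>b\<in>UNIV. \<Sum>c\<in>UNIV.
          M $ x $ a * B $ a $ i * (M $ y $ b * B $ b $ j) * (M $ z $ c * B $ c $ k))"
        by (simp add: matrix_matrix_mult_def sum_product3)
      then show ?thesis
        by (simp add: sum.cartesian_product case_prod_unfold mult_ac)
    qed
    have "tucker (tucker T M) B $ i $ j $ k = (\<Sum>(a, b, c)\<in>UNIV. \<Sum>(x, y, z)\<in>UNIV.
        T $ x $ y $ z * (M $ x $ a * M $ y $ b * M $ z $ c * (B $ a $ i * B $ b $ j * B $ c $ k)))"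
      unfolding tucker_triple by (simp only: case_prod_unfold sum_distrib_right mult.assoc)
    also have "\<dots> = (\<Sum>(x, y, z)\<in>UNIV. \<Sum>(a, b, c)\<in>UNIV.
        T $ x $ y $ z * (M $ x $ a * M $ y $ b * M $ z $ c * (B $ a $ i * B $ b $ j * B $ c $ k)))"
      unfolding case_prod_unfold by (rule sum.swap)
    also have "\<dots> = tucker T (M ** B) $ i $ j $ k"
      unfolding tucker_triple case_prod_unfold sum_distrib_left[symmetric]
        *[unfolded case_prod_unfold]
      by (simp only: mult.assoc)
    finally show ?thesis .
  qed
  then show ?thesis by (simp add: vec_eq_iff)
qed

lemma tucker_mat_1: "tucker T (mat 1) = T" for T :: "(real, 'v::finite) tensor3"
proof -
  have "(\<Sum>a\<in>UNIV. f a * (mat 1 :: (real, 'v) matrix2) $ a $ i) = f i" for f i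
    by (simp add: mat_def sum_Kronecker)
  then have "tucker T (mat 1) $ i $ j $ k = T $ i $ j $ k" for i j k
    by (simp add: tucker_def)
  then show ?thesis by (simp add: vec_eq_iff)
qed

lemma Sym3_swap:
  assumes "T \<in> Sym3"
  shows "T $ i $ j $ k = T $ j $ i $ k" "T $ i $ j $ k = T $ i $ k $ j"
  using assms by (auto simp: Sym3_def)

lemma tucker_Sym3:
  fixes T :: "(real, 'v::finite) tensor3"
  assumes "T \<in> Sym3"
  shows "tucker T M \<in> Sym3"
  unfolding Sym3_def
proof (intro CollectI allI conjI)
  fix i j k
  have "tucker T M $ i $ j $ k = (\<Sum>b\<in>UNIV. \<Sum>a\<in>UNIV. \<Sum>c\<in>UNIV.
      T $ a $ b $ c * M $ a $ i * M $ b $ j * M $ c $ k)"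
    unfolding tucker_def by (simp, rule sum.swap)
  also have "\<dots> = tucker T M $ j $ i $ k"
    unfolding tucker_def by (auto intro!: sum.cong simp: Sym3_swap(1)[OF assms] mult_ac)
  finally show "tucker T M $ i $ j $ k = tucker T M $ j $ i $ k" .
  have "tucker T M $ i $ j $ k = (\<Sum>a\<in>UNIV. \<Sum>c\<in>UNIV. \<Sum>b\<in>UNIV.
      T $ a $ b $ c * M $ a $ i * M $ b $ j * M $ c $ k)"
    unfolding tucker_def by (simp, intro sum.cong refl sum.swap)
  also have "\<dots> = tucker T M $ i $ k $ j"
    unfolding tucker_def
    by (simp, intro sum.cong refl, subst Sym3_swap(2)[OF assms], simp)
  finally show "tucker T M $ i $ j $ k = tucker T M $ i $ k $ j" .
qed

section \<open>Coordinates and the equations of the trek ideal\<close>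

lemma Rep_Abs_sort:
  "Rep_moment_var (Abs_moment_var (sort [i, j])) = sort [i, j]"
  "Rep_moment_var (Abs_moment_var (sort [i, j, k])) = sort [i, j, k]"
  by (rule Abs_moment_var_inverse; simp del: sort_key_simps)+

text \<open>Sorting the indices is harmless because \<open>S\<close> is symmetric.\<close>

lemma eval_at_svar:
  assumes "sym_matrix S"
  shows "eval_at (S, T) (svar i j) = S $ i $ j"
proof -
  have "S $ i $ j = S $ j $ i"
    using assms by (simp add: sym_matrix_def transpose_def vec_eq_iff)
  then show ?thesis
    by (simp add: eval_at_def svar_def Rep_Abs_sort del: sort_key_simps) (simp add: insort_key.simps)
qed

lemma eval_at_tvar:
  assumes "T \<in> Sym3"
  shows "eval_at (S, T) (tvar i j k) = T $ i $ j $ k"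
proof -
  have "T $ i $ j $ k = T $ j $ i $ k" "T $ i $ j $ k = T $ i $ k $ j" for i j k
    using assms by (auto simp: Sym3_def)
  then have "T $ i $ j $ k = T $ i $ k $ j \<and> T $ i $ j $ k = T $ j $ i $ k \<and> T $ i $ j $ k = T $ j $ k $ i
      \<and> T $ i $ j $ k = T $ k $ i $ j \<and> T $ i $ j $ k = T $ k $ j $ i"
    by metis
  then show ?thesis
    by (simp add: eval_at_def tvar_def Rep_Abs_sort del: sort_key_simps) (auto simp: insort_key.simps)
qed

lemma complexify_symmetric:
  assumes "sym_matrix S" "T \<in> Sym3"
  shows "sym_matrix (fst (complexify (S, T)))" "snd (complexify (S, T)) \<in> Sym3"
  using assms by (auto simp: complexify_def sym_matrix_def transpose_def Sym3_def vec_eq_iff)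

lemma eval_at_complexify:
  assumes "sym_matrix S" "T \<in> Sym3"
  shows "eval_at (complexify (S, T)) (svar i j) = of_real (S $ i $ j)"
    and "eval_at (complexify (S, T)) (tvar i j k) = of_real (T $ i $ j $ k)"
proof -
  obtain S' T' where ST: "complexify (S, T) = (S', T')" by fastforce
  with complexify_symmetric[OF assms] have "sym_matrix S'" "T' \<in> Sym3" by auto
  with ST show "eval_at (complexify (S, T)) (svar i j) = of_real (S $ i $ j)"
      "eval_at (complexify (S, T)) (tvar i j k) = of_real (T $ i $ j $ k)"
    by (auto simp: eval_at_svar eval_at_tvar complexify_def)
qed

text \<open>The real value of \<open>trek_entry\<close>, which lets the minors be treated without
  polynomials.\<close>

fun column_entry :: "(real, 'v::finite) matrix2 \<times> (real, 'v) tensor3 \<Rightarrow> 'v \<Rightarrow> 'v trek_col \<Rightarrow> real" where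
  "column_entry (S, T) i (SCol k) = S $ i $ k"
| "column_entry (S, T) i (TCol l m) = T $ i $ l $ m"

lemma eval_at_trek_entry:
  assumes "sym_matrix S" "T \<in> Sym3"
  shows "eval_at (complexify (S, T)) (trek_entry i c) = of_real (column_entry (S, T) i c)"
  by (cases c) (simp_all add: eval_at_complexify[OF assms])

text \<open>Only generators need testing, and at a real point their values are embedded real
  numbers.\<close>

lemma zero_locus_trek_ideal_iff:
  assumes "sym_matrix S" "T \<in> Sym3"
  shows "complexify (S, T) \<in> zero_locus (trek_ideal E) \<longleftrightarrow>
    (\<forall>i j. \<not> trek_exists E [i, j] \<longrightarrow> S $ i $ j = 0) \<and>
    (\<forall>i j k. \<not> trek_exists E [i, j, k] \<longrightarrow> T $ i $ j $ k = 0) \<and>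
    (\<forall>(i, j)\<in>E. \<forall>c\<in>trek_cols E i j. \<forall>d\<in>trek_cols E i j.
      column_entry (S, T) i c * column_entry (S, T) j d = column_entry (S, T) i d * column_entry (S, T) j c)"
proof -
  let ?ev = "eval_at (complexify (S, T))" and ?e = "column_entry (S, T)"
  have minor: "?ev (trek_entry i c * trek_entry j d - trek_entry i d * trek_entry j c)
      = of_real (?e i c * ?e j d - ?e i d * ?e j c)" for i j c d
    using eval_at_trek_entry[OF assms] by (simp add: eval_at_def peval_diff peval_mult)
  have minors: "(\<forall>p\<in>trek_minors E i j. ?ev p = 0) \<longleftrightarrow>
      (\<forall>c\<in>trek_cols E i j. \<forall>d\<in>trek_cols E i j. ?e i c * ?e j d = ?e i d * ?e j c)" for i j
  proof -
    have "(\<forall>p\<in>trek_minors E i j. ?ev p = 0) \<longleftrightarrow>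
        (\<forall>c\<in>trek_cols E i j. \<forall>d\<in>trek_cols E i j. c \<noteq> d \<longrightarrow>
          ?ev (trek_entry i c * trek_entry j d - trek_entry i d * trek_entry j c) = 0)"
      unfolding trek_minors_def by blast
    also have "\<dots> \<longleftrightarrow> (\<forall>c\<in>trek_cols E i j. \<forall>d\<in>trek_cols E i j. ?e i c * ?e j d = ?e i d * ?e j c)"
      unfolding minor of_real_eq_0_iff right_minus_eq by metis
    finally show ?thesis .
  qed
  have "complexify (S, T) \<in> zero_locus (trek_ideal E) \<longleftrightarrow> (\<forall>p\<in>trek_ideal E. ?ev p = 0)"
    using complexify_symmetric[OF assms] by (cases "complexify (S, T)") (simp add: zero_locus_def)
  also have "\<dots> \<longleftrightarrow> (\<forall>p\<in>no_trek_vars E \<union> (\<Union>(i, j)\<in>E. trek_minors E i j). ?ev p = 0)"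
    unfolding trek_ideal_def eval_at_def by (rule vanishing_ideal_gen)
  also have "\<dots> \<longleftrightarrow> (\<forall>p\<in>no_trek_vars E. ?ev p = 0) \<and> (\<forall>(i, j)\<in>E. \<forall>p\<in>trek_minors E i j. ?ev p = 0)"
    by auto
  also have "(\<forall>p\<in>no_trek_vars E. ?ev p = 0) \<longleftrightarrow>
      (\<forall>i j. \<not> trek_exists E [i, j] \<longrightarrow> ?ev (svar i j) = 0) \<and>
      (\<forall>i j k. \<not> trek_exists E [i, j, k] \<longrightarrow> ?ev (tvar i j k) = 0)"
    unfolding no_trek_vars_def by blast
  finally show ?thesis
    by (simp add: minors eval_at_complexify[OF assms])
qed

section \<open>The model satisfies the equations\<close>

text \<open>The parametrization as a trek rule: every top \<open>a\<close> contributes its diagonal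
  weight times the path coefficients to the indices.\<close>

lemma moment_modelE:
  assumes "(S, T) \<in> moment_model E" "acyclic E"
  obtains \<Lambda> w2 w3 where "\<Lambda> \<in> edge_matrices E" "S \<in> PD" "T \<in> Sym3"
    and "\<And>i j. S $ i $ j = (\<Sum>a\<in>UNIV. w2 a
      * matrix_inv (mat 1 - \<Lambda>) $ a $ i * matrix_inv (mat 1 - \<Lambda>) $ a $ j)"
    and "\<And>i j k. T $ i $ j $ k = (\<Sum>a\<in>UNIV. w3 a * matrix_inv (mat 1 - \<Lambda>) $ a $ i
      * matrix_inv (mat 1 - \<Lambda>) $ a $ j * matrix_inv (mat 1 - \<Lambda>) $ a $ k)"
proof -
  obtain \<Lambda> \<Omega>2 \<Omega>3 where \<Lambda>: "\<Lambda> \<in> edge_matrices E"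
      and \<Omega>: "\<Omega>2 \<in> PD" "diagonal_matrix \<Omega>2" "\<Omega>3 \<in> Sym3" "diagonal_tensor \<Omega>3"
      and ST: "S = transpose (matrix_inv (mat 1 - \<Lambda>)) ** \<Omega>2 ** matrix_inv (mat 1 - \<Lambda>)"
        "T = tucker \<Omega>3 (matrix_inv (mat 1 - \<Lambda>))"
    using assms(1) unfolding moment_model_def by blast
  have "invertible (matrix_inv (mat 1 - \<Lambda>))"
    using path_matrix_inverse[OF assms(2) \<Lambda>] unfolding invertible_def by blast
  show ?thesis
    using \<Omega> ST \<Lambda> \<open>invertible _\<close> congruence_PD tucker_Sym3 congruence_diagonal tucker_diagonal
    by (intro that[of \<Lambda> "\<lambda>a. \<Omega>2 $ a $ a" "\<lambda>a. \<Omega>3 $ a $ a $ a"]) auto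
qed

lemma moment_model_no_trek:
  fixes E :: "('v::finite \<times> 'v) set"
  assumes "(S, T) \<in> moment_model E" "acyclic E"
  shows "\<not> trek_exists E [i, j] \<Longrightarrow> S $ i $ j = 0"
    and "\<not> trek_exists E [i, j, k] \<Longrightarrow> T $ i $ j $ k = 0"
proof -
  obtain \<Lambda> w2 w3 where \<Lambda>: "\<Lambda> \<in> edge_matrices E" and "S \<in> PD" "T \<in> Sym3"
    and S: "\<And>i j. S $ i $ j = (\<Sum>a\<in>UNIV. w2 a
      * matrix_inv (mat 1 - \<Lambda>) $ a $ i * matrix_inv (mat 1 - \<Lambda>) $ a $ j)"
    and T: "\<And>i j k. T $ i $ j $ k = (\<Sum>a\<in>UNIV. w3 a * matrix_inv (mat 1 - \<Lambda>) $ a $ i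
      * matrix_inv (mat 1 - \<Lambda>) $ a $ j * matrix_inv (mat 1 - \<Lambda>) $ a $ k)"
    by (rule moment_modelE[OF assms]) (rule that)
  show "S $ i $ j = 0" if "\<not> trek_exists E [i, j]"
    unfolding S using that path_matrix_support[OF assms(2) \<Lambda>]
    by (intro sum.neutral) (auto simp: trek_exists_iff common_ancestors_def)
  show "T $ i $ j $ k = 0" if "\<not> trek_exists E [i, j, k]"
    unfolding T using that path_matrix_support[OF assms(2) \<Lambda>]
    by (intro sum.neutral) (auto simp: trek_exists_iff common_ancestors_def)
qed

text \<open>The factor \<open>l\<close> is the edge coefficient; it is the same for all columns,
  which makes the rows proportional.\<close>

lemma moment_model_trek_column:
  fixes E :: "('v::{finite, linorder} \<times> 'v) set"
  assumes "polytree E" "(S, T) \<in> moment_model E" "(i, j) \<in> E"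
  shows "\<exists>l. \<forall>c\<in>trek_cols E i j. column_entry (S, T) j c = l * column_entry (S, T) i c"
proof -
  have ac: "acyclic E"
    by (rule polytree_acyclic) fact
  obtain \<Lambda> w2 w3 where \<Lambda>: "\<Lambda> \<in> edge_matrices E" and "S \<in> PD" "T \<in> Sym3"
    and S: "\<And>i j. S $ i $ j = (\<Sum>a\<in>UNIV. w2 a
      * matrix_inv (mat 1 - \<Lambda>) $ a $ i * matrix_inv (mat 1 - \<Lambda>) $ a $ j)"
    and T: "\<And>i j k. T $ i $ j $ k = (\<Sum>a\<in>UNIV. w3 a * matrix_inv (mat 1 - \<Lambda>) $ a $ i
      * matrix_inv (mat 1 - \<Lambda>) $ a $ j * matrix_inv (mat 1 - \<Lambda>) $ a $ k)"
    by (rule moment_modelE[OF assms(2) ac]) (rule that)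
  let ?B = "matrix_inv (mat 1 - \<Lambda>)"
  \<comment> \<open>Proportionality already holds for each source \<open>a\<close>, with
    \<open>x\<close> the rest of its summand. If \<open>a\<close> reaches \<open>i\<close>, it is
    \<open>path_matrix_edge\<close>; otherwise both sides are zero.\<close>
  have step: "?B $ a $ j * x = \<Lambda> $ i $ j * (?B $ a $ i * x)"
    if "same_top E (i # is) (j # is)" and x: "\<And>k. k \<in> set is \<Longrightarrow> (a, k) \<notin> E\<^sup>* \<Longrightarrow> x = 0" for a x "is"
  proof (cases "(a, i) \<in> E\<^sup>*")
    case True
    then show ?thesis
      using path_matrix_edge[OF ac \<Lambda> assms(1) True assms(3)] by simp
  next
    case False
    then have "a \<notin> common_ancestors E (j # is)"
      using same_top_reaches[OF assms(1) that(1)] by blast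
    then have "?B $ a $ j = 0 \<or> x = 0"
      using path_matrix_support[OF ac \<Lambda>] x by (auto simp: common_ancestors_def)
    moreover have "?B $ a $ i = 0"
      using False by (rule path_matrix_support[OF ac \<Lambda>])
    ultimately show ?thesis by auto
  qed
  have "column_entry (S, T) j c = \<Lambda> $ i $ j * column_entry (S, T) i c" if c: "c \<in> trek_cols E i j" for c
  proof (cases c)
    case (SCol k)
    with c have st: "same_top E [i, k] [j, k]"
      by (auto simp: trek_cols_def)
    have "?B $ a $ j * (w2 a * ?B $ a $ k) = \<Lambda> $ i $ j * (?B $ a $ i * (w2 a * ?B $ a $ k))" for a
      by (rule step[OF st]) (simp add: path_matrix_support[OF ac \<Lambda>])
    then have eq: "w2 a * ?B $ a $ j * ?B $ a $ k = \<Lambda> $ i $ j * (w2 a * ?B $ a $ i * ?B $ a $ k)" for a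
      by (simp only: mult_ac)
    show ?thesis
      by (simp only: SCol column_entry.simps S sum_distrib_left eq)
  next
    case (TCol l m)
    with c have st: "same_top E [i, l, m] [j, l, m]"
      by (auto simp: trek_cols_def)
    have "?B $ a $ j * (w3 a * ?B $ a $ l * ?B $ a $ m)
        = \<Lambda> $ i $ j * (?B $ a $ i * (w3 a * ?B $ a $ l * ?B $ a $ m))" for a
      by (rule step[OF st]) (auto simp: path_matrix_support[OF ac \<Lambda>])
    then have eq: "w3 a * ?B $ a $ j * ?B $ a $ l * ?B $ a $ m
        = \<Lambda> $ i $ j * (w3 a * ?B $ a $ i * ?B $ a $ l * ?B $ a $ m)" for a
      by (simp only: mult_ac)
    show ?thesis
      by (simp only: TCol column_entry.simps T sum_distrib_left eq)
  qed
  then show ?thesis by blast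
qed

section \<open>Recovering the parameters from the equations\<close>

text \<open>Serves to bring the indices of a column \<open>TCol\<close> into sorted order.\<close>

lemma same_top_cong:
  assumes "polytree E" "is \<noteq> []" "js \<noteq> []" "set is = set is'" "set js = set js'"
  shows "same_top E is js \<longleftrightarrow> same_top E is' js'"
proof -
  have "common_ancestors E is = common_ancestors E is'" "common_ancestors E js = common_ancestors E js'"
      "is' \<noteq> []" "js' \<noteq> []"
    using assms by (auto simp: common_ancestors_def)
  then show ?thesis
    using assms(2,3) by (simp add: same_top_def trek_exists_iff top_of_def simple_trek_iff_lowest[OF assms(1)])
qed

text \<open>Here \<open>x\<close> is \<open>S\<close> or \<open>T\<close> with its remaining indices
  fixed to \<open>ks\<close>. If \<open>j # ks\<close> has a common ancestor, exactly one parent of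
  \<open>j\<close> shares one with \<open>ks\<close>, and its contribution cancels
  \<open>x j\<close>; otherwise all terms are zero.\<close>

lemma edge_elimination:
  fixes E :: "('v::finite \<times> 'v) set" and x :: "'v \<Rightarrow> real"
  assumes E: "polytree E" and \<Lambda>: "\<Lambda> \<in> edge_matrices E"
    and zero: "\<And>i. \<not> trek_exists E (i # ks) \<Longrightarrow> x i = 0"
    and edge: "\<And>p j. (p, j) \<in> E \<Longrightarrow> same_top E (p # ks) (j # ks) \<Longrightarrow> x j = \<Lambda> $ p $ j * x p"
    and nr: "\<exists>k\<in>set ks. (j, k) \<notin> E\<^sup>*"
  shows "(\<Sum>a\<in>UNIV. (mat 1 - \<Lambda>) $ a $ j * x a) = 0"
proof -
  have "(\<Sum>a\<in>UNIV. (mat 1 - \<Lambda>) $ a $ j * x a) = x j - (\<Sum>p\<in>UNIV. \<Lambda> $ p $ j * x p)"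
    using sum_Kronecker(1)[of x j] by (simp add: mat_def left_diff_distrib right_diff_distrib sum_subtractf mult.commute)
  moreover have "x j = (\<Sum>p\<in>UNIV. \<Lambda> $ p $ j * x p)"
  proof (cases "common_ancestors E (j # ks) = {}")
    case True
    have "\<Lambda> $ p $ j * x p = 0" for p
    proof (cases "(p, j) \<in> E")
      case pj: True
      then have "common_ancestors E (p # ks) \<subseteq> common_ancestors E (j # ks)"
        by (auto simp: common_ancestors_def)
      with True show ?thesis
        by (simp add: zero trek_exists_iff)
    next
      case False
      with \<Lambda> show ?thesis by (simp add: edge_matrices_def)
    qed
    with True show ?thesis
      by (simp add: zero trek_exists_iff sum.neutral)
  next
    case False
    then obtain a where a: "(a, j) \<in> E\<^sup>*" "\<And>k. k \<in> set ks \<Longrightarrow> (a, k) \<in> E\<^sup>*"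
      by (auto simp: common_ancestors_def)
    \<comment> \<open>The vertex \<open>a\<close> reaches all of \<open>ks\<close> and
      \<open>j\<close> does not, so the path from \<open>a\<close> to \<open>j\<close> has a last
      edge.\<close>
    with nr have "a \<noteq> j" by blast
    with a(1) obtain p where p: "(a, p) \<in> E\<^sup>*" "(p, j) \<in> E"
      by (metis rtranclE)
    have ne: "common_ancestors E (p # ks) \<noteq> {}"
      using a(2) p(1) by (auto simp: common_ancestors_def)
    then have "same_top E (p # ks) (j # ks)"
      using common_ancestors_parent[OF E p(2) _ nr] by (intro same_topI[OF E]) auto
    then have xj: "x j = \<Lambda> $ p $ j * x p"
      using edge p(2) by blast
    \<comment> \<open>A second parent sharing an ancestor with \<open>ks\<close> would also lie
      below \<open>a\<close>, against \<open>polytree_unique_parent\<close>.\<close>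
    have "\<Lambda> $ q $ j * x q = 0" if "q \<noteq> p" for q
    proof (cases "(q, j) \<in> E")
      case True
      have "common_ancestors E (q # ks) = {}"
      proof (rule ccontr)
        assume "common_ancestors E (q # ks) \<noteq> {}"
        then have "common_ancestors E (q # ks) = common_ancestors E (j # ks)"
          using common_ancestors_parent[OF E True _ nr] by blast
        moreover have "a \<in> common_ancestors E (j # ks)"
          using a by (simp add: common_ancestors_def)
        ultimately have "(a, q) \<in> E\<^sup>*"
          by (auto simp: common_ancestors_def)
        then show False
          using polytree_unique_parent[OF E True p(2) _ p(1)] that by blast
      qed
      then show ?thesis
        by (simp add: zero trek_exists_iff)
    next
      case False
      with \<Lambda> show ?thesis by (simp add: edge_matrices_def)
    qed
    then have "(\<Sum>q\<in>UNIV - {p}. \<Lambda> $ q $ j * x q) = 0"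
      by (intro sum.neutral ballI) blast
    then show ?thesis
      by (subst sum.remove[of _ p]) (auto simp: xj)
  qed
  ultimately show ?thesis by simp
qed

lemma moment_modelI:
  fixes E :: "('v::{finite, linorder} \<times> 'v) set"
  assumes E: "polytree E" and S: "S \<in> PD" and T: "T \<in> Sym3"
    and zero2: "\<And>i j. \<not> trek_exists E [i, j] \<Longrightarrow> S $ i $ j = 0"
    and zero3: "\<And>i j k. \<not> trek_exists E [i, j, k] \<Longrightarrow> T $ i $ j $ k = 0"
    and minors: "\<And>i j c d. (i, j) \<in> E \<Longrightarrow> c \<in> trek_cols E i j \<Longrightarrow> d \<in> trek_cols E i j \<Longrightarrow>
      column_entry (S, T) i c * column_entry (S, T) j d = column_entry (S, T) i d * column_entry (S, T) j c"
  shows "(S, T) \<in> moment_model E"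
proof -
  have ac: "acyclic E"
    by (rule polytree_acyclic) fact
  define \<Lambda> :: "(real, 'v) matrix2" where "\<Lambda> = (\<chi> i j. if (i, j) \<in> E then S $ i $ j / S $ i $ i else 0)"
  have \<Lambda>: "\<Lambda> \<in> edge_matrices E"
    by (simp add: \<Lambda>_def edge_matrices_def)
  define M where "M = mat 1 - \<Lambda>"
  have column: "column_entry (S, T) j c = \<Lambda> $ i $ j * column_entry (S, T) i c"
    if ij: "(i, j) \<in> E" and c: "c \<in> trek_cols E i j" for i j c
  proof -
    \<comment> \<open>Ancestors of \<open>i\<close> are ancestors of \<open>j\<close>, so
      \<open>SCol i\<close> is always a column; its entry \<open>S $ i $ i\<close> is positive and
      can be divided out.\<close>
    have "same_top E [i, i] [j, i]"
      using ij by (intro same_topI[OF E]) (auto simp: common_ancestors_def)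
    then have "SCol i \<in> trek_cols E i j"
      by (simp add: trek_cols_def)
    then have "S $ i $ i * column_entry (S, T) j c = column_entry (S, T) i c * S $ j $ i"
      using minors[OF ij _ c] by fastforce
    then show ?thesis
      using PD_diag_pos[OF S, of i] PD_sym[OF S, of i j] ij by (simp add: \<Lambda>_def field_simps)
  qed
  have elim2: "(\<Sum>a\<in>UNIV. M $ a $ i * S $ a $ b) = 0" if "(i, b) \<notin> E\<^sup>*" for i b
    unfolding M_def
  proof (rule edge_elimination[OF E \<Lambda>, where ks = "[b]"])
    fix p j assume "(p, j) \<in> E" "same_top E [p, b] [j, b]"
    then show "S $ j $ b = \<Lambda> $ p $ j * S $ p $ b"
      using column[of p j "SCol b"] by (simp add: trek_cols_def)
  qed (use zero2 that in auto)
  have elim3: "(\<Sum>a\<in>UNIV. M $ a $ i * T $ a $ b $ c) = 0"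
    if "(i, b) \<notin> E\<^sup>* \<or> (i, c) \<notin> E\<^sup>*" for i b c
    unfolding M_def
  proof (rule edge_elimination[OF E \<Lambda>, where ks = "[b, c]"])
    fix p j assume pj: "(p, j) \<in> E" "same_top E [p, b, c] [j, b, c]"
    \<comment> \<open>Only sorted pairs index columns, so both orders of \<open>b\<close> and
      \<open>c\<close> are prepared.\<close>
    then have "same_top E [p, c, b] [j, c, b]"
      by (subst same_top_cong[OF E, of _ _ "[p, b, c]" "[j, b, c]"]) auto
    with pj have "TCol b c \<in> trek_cols E p j \<or> TCol c b \<in> trek_cols E p j"
      by (cases "b \<le> c") (auto simp: trek_cols_def)
    then show "T $ j $ b $ c = \<Lambda> $ p $ j * T $ p $ b $ c"
      using column[OF pj(1), of "TCol b c"] column[OF pj(1), of "TCol c b"] Sym3_swap(2)[OF T, of _ b c]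
      by auto
  qed (use zero3 that in auto)
  have M_reach: "M $ b $ j = 0" if "(b, j) \<notin> E\<^sup>*" for b j
    using that by (auto simp: M_def mat_def \<Lambda>_def)
  define \<Omega>2 where "\<Omega>2 = transpose M ** S ** M"
  define \<Omega>3 where "\<Omega>3 = tucker T M"
  have \<Omega>2: "\<Omega>2 \<in> PD"
    unfolding \<Omega>2_def M_def by (intro congruence_PD S invertible_one_minus[OF ac \<Lambda>])
  have \<Omega>3: "\<Omega>3 \<in> Sym3"
    unfolding \<Omega>3_def by (rule tucker_Sym3[OF T])
  have \<Omega>2_0: "\<Omega>2 $ i $ j = 0" if "(i, j) \<notin> E\<^sup>*" for i j
    unfolding \<Omega>2_def congruence_nth
  proof (rule sum.neutral, rule ballI)
    fix b
    \<comment> \<open>A nonzero term would need \<open>i\<close> to reach \<open>b\<close>, by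
      elimination, and \<open>b\<close> to reach \<open>j\<close>, by the support of
      \<open>M\<close>.\<close>
    have "(b, j) \<notin> E\<^sup>* \<or> (i, b) \<notin> E\<^sup>*"
      using that rtrancl_trans by metis
    then show "M $ b $ j * (\<Sum>a\<in>UNIV. M $ a $ i * S $ a $ b) = 0"
      using M_reach elim2 by auto
  qed
  have diag2: "diagonal_matrix \<Omega>2"
    unfolding diagonal_matrix_def
    using \<Omega>2_0 PD_sym[OF \<Omega>2] acyclic_reach_antisym[OF ac] by metis
  have \<Omega>3_0: "\<Omega>3 $ i $ j $ k = 0" if "(i, j) \<notin> E\<^sup>* \<or> (i, k) \<notin> E\<^sup>*" for i j k
    unfolding \<Omega>3_def tucker_nth
  proof (intro sum.neutral ballI)
    fix b c
    have "(b, j) \<notin> E\<^sup>* \<or> (c, k) \<notin> E\<^sup>* \<or> (i, b) \<notin> E\<^sup>* \<or> (i, c) \<notin> E\<^sup>*"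
      using that rtrancl_trans by metis
    then show "M $ b $ j * M $ c $ k * (\<Sum>a\<in>UNIV. M $ a $ i * T $ a $ b $ c) = 0"
      using M_reach elim3 by auto
  qed
  have diag3: "diagonal_tensor \<Omega>3"
    unfolding diagonal_tensor_def
  proof (intro allI impI)
    fix i j k :: 'v assume "\<not> (i = j \<and> j = k)"
    \<comment> \<open>If all three cases failed, \<open>i\<close>, \<open>j\<close> and
      \<open>k\<close> would reach each other and coincide. Symmetry moves the index that fails to
      reach another one to the front.\<close>
    then consider "(i, j) \<notin> E\<^sup>*" | "(j, i) \<notin> E\<^sup>* \<or> (j, k) \<notin> E\<^sup>*" | "(k, j) \<notin> E\<^sup>*"
      using acyclic_reach_antisym[OF ac] by metis
    then show "\<Omega>3 $ i $ j $ k = 0"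
    proof cases
      case 1
      then show ?thesis using \<Omega>3_0 by blast
    next
      case 2
      then show ?thesis using \<Omega>3_0 Sym3_swap(1)[OF \<Omega>3] by metis
    next
      case 3
      then show ?thesis using \<Omega>3_0[of k i j] Sym3_swap[OF \<Omega>3] by metis
    qed
  qed
  let ?B = "matrix_inv M"
  have MB: "M ** ?B = mat 1"
    unfolding M_def by (rule path_matrix_inverse(2)[OF ac \<Lambda>])
  have "transpose ?B ** \<Omega>2 ** ?B = transpose (M ** ?B) ** S ** (M ** ?B)"
    by (simp add: \<Omega>2_def matrix_transpose_mul matrix_mul_assoc)
  then have "S = transpose ?B ** \<Omega>2 ** ?B"
    by (simp add: MB)
  moreover have "T = tucker \<Omega>3 ?B"
    by (simp add: \<Omega>3_def tucker_tucker MB tucker_mat_1)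
  ultimately show ?thesis
    unfolding moment_model_def using \<Lambda> \<Omega>2 \<Omega>3 diag2 diag3 by (auto simp: M_def)
qed

theorem moment_model_eq_zero_locus:
  fixes E :: "('v::{finite, linorder} \<times> 'v) set"
  assumes E: "polytree E"
  shows "moment_model E = (complexify -` zero_locus (trek_ideal E)) \<inter> (PD \<times> Sym3)"
proof (intro set_eqI iffI)
  fix ST :: "(real, 'v) matrix2 \<times> (real, 'v) tensor3"
  have ac: "acyclic E"
    by (rule polytree_acyclic) fact
  assume ST: "ST \<in> moment_model E"
  obtain S T where "ST = (S, T)"
    by fastforce
  moreover from this have "S \<in> PD" "T \<in> Sym3"
    using moment_modelE[OF _ ac, of S T] ST by metis+
  moreover from this have "sym_matrix S" by (simp add: PD_def)
  moreover have "column_entry (S, T) i c * column_entry (S, T) j d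
      = column_entry (S, T) i d * column_entry (S, T) j c"
    if ij: "(i, j) \<in> E" and "c \<in> trek_cols E i j" "d \<in> trek_cols E i j" for i j c d
  proof -
    obtain l where "\<forall>c\<in>trek_cols E i j. column_entry (S, T) j c = l * column_entry (S, T) i c"
      using moment_model_trek_column[OF E _ ij] ST \<open>ST = (S, T)\<close> by metis
    with that(2,3) show ?thesis by simp
  qed
  ultimately show "ST \<in> (complexify -` zero_locus (trek_ideal E)) \<inter> (PD \<times> Sym3)"
    using ST moment_model_no_trek[OF _ ac] by (simp add: zero_locus_trek_ideal_iff case_prod_beta)
next
  fix ST :: "(real, 'v) matrix2 \<times> (real, 'v) tensor3"
  assume "ST \<in> (complexify -` zero_locus (trek_ideal E)) \<inter> (PD \<times> Sym3)"
  then obtain S T where ST: "ST = (S, T)" "S \<in> PD" "T \<in> Sym3"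
      "complexify (S, T) \<in> zero_locus (trek_ideal E)"
    by auto
  moreover from this have "sym_matrix S" by (simp add: PD_def)
  ultimately show "ST \<in> moment_model E"
    using moment_modelI[OF E, of S T] by (simp add: zero_locus_trek_ideal_iff) blast
qed

section \<open>Linear polynomials in the moment ideal\<close>

text \<open>With \<open>\<lambda>\<^sub>i\<^sub>j = y\<^sub>j / y\<^sub>i\<close> the path products telescope; \<open>\<omega>\<^sub>a = y\<^sub>a\<^sup>2\<close> and \<open>\<omega>\<^sub>a = y\<^sub>a\<^sup>3\<close> then cancel the
  contribution of the source \<open>a\<close>.\<close>

lemma moment_model_torus_point:
  fixes E :: "('v::finite \<times> 'v) set" and y :: "'v \<Rightarrow> real"
  assumes E: "polytree E" and y: "\<And>i. 0 < y i"
  shows "(\<chi> i j. y i * y j * real (card (common_ancestors E [i, j])),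
    \<chi> i j k. y i * y j * y k * real (card (common_ancestors E [i, j, k]))) \<in> moment_model E"
proof -
  have ac: "acyclic E"
    by (rule polytree_acyclic) fact
  define \<Lambda> :: "(real, 'v) matrix2" where "\<Lambda> = (\<chi> i j. if (i, j) \<in> E then y j / y i else 0)"
  have \<Lambda>: "\<Lambda> \<in> edge_matrices E"
    by (simp add: \<Lambda>_def edge_matrices_def)
  let ?B = "matrix_inv (mat 1 - \<Lambda>)"
  have y0: "y i \<noteq> 0" for i
    using y[of i] by simp
  have "?B $ a $ i = y i / y a" if "(a, i) \<in> E\<^sup>*" for a i
    using that
  proof (induction rule: rtrancl_induct)
    case base
    show ?case by (simp add: path_matrix_diag[OF ac \<Lambda>] y0)
  next
    case (step i j)
    then show ?case
      using path_matrix_edge[OF ac \<Lambda> E, of a i j] y0 by (simp add: \<Lambda>_def)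
  qed
  then have B: "?B $ a $ i = (if (a, i) \<in> E\<^sup>* then y i / y a else 0)" for a i
    using path_matrix_support[OF ac \<Lambda>] by simp
  define \<Omega>2 :: "(real, 'v) matrix2" where "\<Omega>2 = (\<chi> i j. if i = j then (y i)\<^sup>2 else 0)"
  define \<Omega>3 :: "(real, 'v) tensor3" where "\<Omega>3 = (\<chi> i j k. if i = j \<and> j = k then (y i) ^ 3 else 0)"
  have \<Omega>: "\<Omega>2 \<in> PD" "diagonal_matrix \<Omega>2" "\<Omega>3 \<in> Sym3" "diagonal_tensor \<Omega>3"
    unfolding \<Omega>2_def \<Omega>3_def
    by (auto intro!: diagonal_PD simp: y y0 diagonal_matrix_def diagonal_tensor_def Sym3_def)
  have "(transpose ?B ** \<Omega>2 ** ?B) $ i $ j = y i * y j * real (card (common_ancestors E [i, j]))" for i j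
  proof -
    \<comment> \<open>Each common ancestor contributes the same amount and every other source zero,
      so the sum becomes a count.\<close>
    have "(transpose ?B ** \<Omega>2 ** ?B) $ i $ j
        = (\<Sum>a\<in>UNIV. if a \<in> common_ancestors E [i, j] then y i * y j else 0)"
      unfolding congruence_diagonal[OF \<Omega>(2)]
      by (rule sum.cong)
        (auto simp: B \<Omega>2_def common_ancestors_def y0 field_simps power2_eq_square)
    then show ?thesis
      by (simp add: sum.If_cases)
  qed
  then have S: "(\<chi> i j. y i * y j * real (card (common_ancestors E [i, j]))) = transpose ?B ** \<Omega>2 ** ?B"
    by (simp add: vec_eq_iff)
  have "tucker \<Omega>3 ?B $ i $ j $ k = y i * y j * y k * real (card (common_ancestors E [i, j, k]))" for i j k
  proof -
    have "tucker \<Omega>3 ?B $ i $ j $ k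
        = (\<Sum>a\<in>UNIV. if a \<in> common_ancestors E [i, j, k] then y i * y j * y k else 0)"
      unfolding tucker_diagonal[OF \<Omega>(4)]
      by (rule sum.cong)
        (auto simp: B \<Omega>3_def common_ancestors_def y0 field_simps power3_eq_cube)
    then show ?thesis
      by (simp add: sum.If_cases)
  qed
  then have T: "(\<chi> i j k. y i * y j * y k * real (card (common_ancestors E [i, j, k]))) = tucker \<Omega>3 ?B"
    by (simp add: vec_eq_iff)
  show ?thesis
    unfolding S T moment_model_def using \<Lambda> \<Omega> by blast
qed

lemma moment_var_cases:
  obtains (s) i j where "x = Abs_moment_var (sort [i, j])" "Rep_moment_var x = [i, j]"
  | (t) i j k where "x = Abs_moment_var (sort [i, j, k])" "Rep_moment_var x = [i, j, k]"
proof -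
  have x: "sorted (Rep_moment_var x)" "length (Rep_moment_var x) = 2 \<or> length (Rep_moment_var x) = 3"
    using Rep_moment_var[of x] by auto
  have "x = Abs_moment_var (sort (Rep_moment_var x))"
    by (simp add: sorted_sort_id[OF x(1)] Rep_moment_var_inverse)
  then show ?thesis
    using x(2) s t by (auto simp: length_Suc_conv numeral_2_eq_2 numeral_3_eq_3 simp del: sort_key_simps)
qed

text \<open>Restricted to the torus points, \<open>p\<close> becomes a combination of distinct
  monomials in \<open>y\<close>, each coefficient multiplied by a count of common ancestors.
  Independence makes the count zero wherever the coefficient is not.\<close>

lemma linear_moment_ideal_keys:
  fixes E :: "('v::{finite, linorder} \<times> 'v) set"
  assumes E: "polytree E" and p: "p \<in> moment_ideal E" "linear_poly p" and m: "m \<in> Poly_Mapping.keys p"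
  shows "\<exists>x. m = Poly_Mapping.single x 1 \<and> \<not> trek_exists E (Rep_moment_var x)"
proof -
  \<comment> \<open>The index list of a variable, which is also its monomial in \<open>y\<close> on
    the torus; the constant monomial gets the empty list.\<close>
  define L where "L m = (if m = 0 then [] else Rep_moment_var (THE x. m = Poly_Mapping.single x (Suc 0)))"
    for m :: "'v moment_var \<Rightarrow>\<^sub>0 nat"
  have single_eq: "Poly_Mapping.single x (Suc 0) = Poly_Mapping.single z (Suc 0) \<longleftrightarrow> x = z" for x z :: "'v moment_var"
    by (metis keys_single singleton_inject nat.distinct(1))
  have single_nz: "Poly_Mapping.single x (Suc 0) \<noteq> 0" for x :: "'v moment_var"
    by (metis keys_single keys_zero insert_not_empty nat.distinct(1))
  have L_0: "L 0 = []" and L_single: "L (Poly_Mapping.single x (Suc 0)) = Rep_moment_var x" for x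
    by (simp_all add: L_def single_eq single_nz)
  have keys: "m = 0 \<or> (\<exists>x. m = Poly_Mapping.single x (Suc 0))" if "m \<in> Poly_Mapping.keys p" for m
    using linear_poly_keys[OF p(2) that] by simp
  have nonempty: "Rep_moment_var x \<noteq> []" for x :: "'v moment_var"
    by (cases x rule: moment_var_cases) auto
  have sorted_Rep: "sorted (Rep_moment_var x)" for x :: "'v moment_var"
    using Rep_moment_var[of x] by simp
  \<comment> \<open>The value 1 at the constant monomial is nonzero, which excludes a constant term
    of \<open>p\<close>.\<close>
  define N where "N m = (if m = 0 then 1 else real (card (common_ancestors E (L m))))" for m
  have "Poly_Mapping.lookup p m * of_real (N m) = 0"
  proof (rule sorted_monomials_independent[where L = L and M = "Poly_Mapping.keys p"
        and c = "\<lambda>m. Poly_Mapping.lookup p m * of_real (N m)"])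
    show "inj_on L (Poly_Mapping.keys p)"
    proof (rule inj_onI)
      fix m n assume "m \<in> Poly_Mapping.keys p" "n \<in> Poly_Mapping.keys p" "L m = L n"
      with keys[of m] keys[of n] show "m = n"
        using nonempty by (auto simp: L_0 L_single Rep_moment_var_inject) (metis nonempty)+
    qed
    show "sorted (L m)" if "m \<in> Poly_Mapping.keys p" for m
      using keys[OF that] sorted_Rep by (auto simp: L_0 L_single)
  next
    fix y :: "'v \<Rightarrow> real" assume y: "\<And>i. 0 < y i"
    let ?S = "\<chi> i j. y i * y j * real (card (common_ancestors E [i, j]))"
    let ?T = "\<chi> i j k. y i * y j * y k * real (card (common_ancestors E [i, j, k]))"
    let ?ev = "\<lambda>x. coordinate (complexify (?S, ?T)) (Rep_moment_var x)"
    have "meval ?ev m = of_real (N m) * of_real (\<Prod>i\<leftarrow>L m. y i)" if "m \<in> Poly_Mapping.keys p" for m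
      using keys[OF that]
    proof (elim disjE exE)
      fix x assume m: "m = Poly_Mapping.single x (Suc 0)"
      show ?thesis
        by (cases x rule: moment_var_cases)
          (auto simp: m L_single N_def single_nz complexify_def)
    qed (simp add: N_def L_0)
    then have "(\<Sum>m\<in>Poly_Mapping.keys p. Poly_Mapping.lookup p m * of_real (N m) * of_real (\<Prod>i\<leftarrow>L m. y i))
        = eval_at (complexify (?S, ?T)) p"
      by (simp add: eval_at_def peval_superset[of "Poly_Mapping.keys p"] mult.assoc)
    also have "\<dots> = 0"
      using p(1) moment_model_torus_point[OF E, of y] y by (simp add: moment_ideal_def)
    finally show "(\<Sum>m\<in>Poly_Mapping.keys p. Poly_Mapping.lookup p m * of_real (N m)
        * of_real (\<Prod>i\<leftarrow>L m. y i)) = 0" .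
  qed (use m in auto)
  then have "N m = 0"
    using m by (simp add: in_keys_iff)
  then have "m \<noteq> 0" and "common_ancestors E (L m) = {}"
    by (auto simp: N_def split: if_splits)
  with keys[OF m] show ?thesis
    by (auto simp: L_single trek_exists_iff)
qed

lemma pvar_in_no_trek_vars:
  assumes "\<not> trek_exists E (Rep_moment_var x)"
  shows "pvar x \<in> no_trek_vars E"
  using assms
  by (cases x rule: moment_var_cases) (auto simp: no_trek_vars_def svar_def tvar_def simp del: sort_key_simps)

text \<open>Every monomial of a linear polynomial in the moment ideal is itself a variable without
  trek, and these variables vanish on the model.\<close>

lemma ideal_gen_linear_moment_ideal:
  fixes E :: "('v::{finite, linorder} \<times> 'v) set"
  assumes E: "polytree E"
  shows "ideal_gen {p \<in> moment_ideal E. linear_poly p} = ideal_gen (no_trek_vars E)"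
proof (rule equalityI; rule ideal_gen_minimal[OF _ is_ideal_ideal_gen])
  show "{p \<in> moment_ideal E. linear_poly p} \<subseteq> ideal_gen (no_trek_vars E)"
  proof safe
    fix p assume p: "p \<in> moment_ideal E" "linear_poly p"
    have "Poly_Mapping.single m 1 \<in> ideal_gen (no_trek_vars E)" if "m \<in> Poly_Mapping.keys p" for m
      using linear_moment_ideal_keys[OF E p that] pvar_in_no_trek_vars[of E] ideal_gen_incl[of "no_trek_vars E"]
      by (auto simp: pvar_def)
    \<comment> \<open>\<open>Poly_Mapping.single 0 c\<close> is the constant polynomial
      \<open>c\<close>, so this sum is \<open>p\<close> written over the generators.\<close>
    then have "(\<Sum>m\<in>Poly_Mapping.keys p. Poly_Mapping.single 0 (Poly_Mapping.lookup p m) * Poly_Mapping.single m 1)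
        \<in> ideal_gen (no_trek_vars E)"
      by (rule ideal_sum_mult[OF is_ideal_ideal_gen])
    then show "p \<in> ideal_gen (no_trek_vars E)"
      using poly_mapping_sum_single[of p] by (simp add: mult_single)
  qed
next
  have "p \<in> moment_ideal E \<and> linear_poly p" if p: "p \<in> no_trek_vars E" for p
  proof
    show "linear_poly p"
      using p by (auto simp: no_trek_vars_def svar_def tvar_def linear_poly_pvar)
    show "p \<in> moment_ideal E"
      unfolding moment_ideal_def
    proof (intro CollectI ballI)
      fix ST assume ST: "ST \<in> moment_model E"
      obtain S T where [simp]: "ST = (S, T)" by fastforce
      have ac: "acyclic E"
        by (rule polytree_acyclic) fact
      have "S \<in> PD" "T \<in> Sym3"
        using moment_modelE[OF _ ac, of S T] ST by (metis \<open>ST = (S, T)\<close>)+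
      then have sym: "sym_matrix S" "T \<in> Sym3"
        by (auto simp: PD_def)
      show "eval_at (complexify ST) p = 0"
        using p moment_model_no_trek[OF _ ac, of S T] ST
        by (auto simp: no_trek_vars_def eval_at_complexify[OF sym])
    qed
  qed
  then show "no_trek_vars E \<subseteq> ideal_gen {p \<in> moment_ideal E. linear_poly p}"
    using ideal_gen_incl[of "{p \<in> moment_ideal E. linear_poly p}"] by blast
qed

theorem theorem3p5:
  fixes E :: "('v::{finite, linorder} \<times> 'v) set"
  assumes "polytree E"
  shows "ideal_gen {p \<in> moment_ideal E. linear_poly p} = ideal_gen (no_trek_vars E)
    \<and> moment_model E = (complexify -` zero_locus (trek_ideal E)) \<inter> (PD \<times> Sym3)"
  using ideal_gen_linear_moment_ideal[OF assms] moment_model_eq_zero_locus[OF assms] by blast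

end
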